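(* There is a sequence of positive numbers $a_n$, $n\ge1$, such that $$d(f)\le a_n\sqrt[n]{k}$$ for any germ of a holomorphic function $f:(\mathbb C^n,0)\to(\mathbb C,0)$, $n\ge1$, of type $A_k$, $k\ge1$, where $d(f)$ is the minimal degree of a polynomial $p\in\mathbb C[x_1,\dots,x_n]$ right equivalent to $f$ at the origin.
   Context: Two germs $f,p:(\mathbb C^n,0)\to(\mathbb C,0)$ are right equivalent if $p=f\circ\varphi$ for some local biholomorphism $\varphi:(\mathbb C^n,0)\to(\mathbb C^n,0)$. A germ is of type $A_k$ if it is right equivalent to $y_1^{k+1}+y_2^2+\dots+y_n^2$. The number $a_n$ depends only on $n$ (not on $f$ or $k$). *)

theory Defs
  imports "HOL-Analysis.Analysis" "HOL-Library.Poly_Mapping"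
begin

text \<open>
  The dimension \<open>n\<close> is quantified inside the statement, so \<open>\<complex>\<^sup>n\<close> is a set rather than a type:
  the complex sequences vanishing from index \<open>n\<close> on. The coordinates \<open>x\<^sub>1, \<dots>, x\<^sub>n\<close>
  have the indices \<open>0, \<dots>, n - 1\<close>. The subspace topology inherited from the (product) topology of
  \<^typ>\<open>nat \<Rightarrow> complex\<close> is the Euclidean one.
\<close>

definition cspace :: "nat \<Rightarrow> (nat \<Rightarrow> complex) set" where
  "cspace n = {z. \<forall>i\<ge>n. z i = 0}"

definition cnorm :: "nat \<Rightarrow> (nat \<Rightarrow> complex) \<Rightarrow> real" where
  "cnorm n z = L2_set (\<lambda>i. cmod (z i)) {..<n}"

definition open_nbhd0 :: "nat \<Rightarrow> (nat \<Rightarrow> complex) set \<Rightarrow> bool" where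
  "open_nbhd0 n U \<longleftrightarrow> openin (top_of_set (cspace n)) U \<and> (\<lambda>_. 0) \<in> U"


text \<open>
  Holomorphic means complex (Frechet) differentiable at every point of an open set;
  the coefficients \<open>c i\<close> are the partial derivatives.
\<close>

definition complex_differentiable ::
    "nat \<Rightarrow> ((nat \<Rightarrow> complex) \<Rightarrow> complex) \<Rightarrow> (nat \<Rightarrow> complex) \<Rightarrow> bool" where
  "complex_differentiable n f z \<longleftrightarrow>
     (\<exists>c :: nat \<Rightarrow> complex.
        ((\<lambda>w. cmod (f w - f z - (\<Sum>i<n. c i * (w i - z i))) / cnorm n (\<lambda>i. w i - z i))
          \<longlongrightarrow> 0) (at z within cspace n))"

definition holomorphic_Cn ::
    "nat \<Rightarrow> ((nat \<Rightarrow> complex) \<Rightarrow> complex) \<Rightarrow> (nat \<Rightarrow> complex) set \<Rightarrow> bool" where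
  "holomorphic_Cn n f U \<longleftrightarrow>
     openin (top_of_set (cspace n)) U \<and> (\<forall>z\<in>U. complex_differentiable n f z)"

definition holomorphic_map_Cn ::
    "nat \<Rightarrow> ((nat \<Rightarrow> complex) \<Rightarrow> (nat \<Rightarrow> complex)) \<Rightarrow> (nat \<Rightarrow> complex) set \<Rightarrow> bool" where
  "holomorphic_map_Cn n \<phi> U \<longleftrightarrow>
     \<phi> ` U \<subseteq> cspace n \<and> (\<forall>i<n. holomorphic_Cn n (\<lambda>z. \<phi> z i) U)"


text \<open>
  Germs at the origin are given by representatives, which are total functions whose values away
  from a small neighbourhood of the origin in \<open>\<complex>\<^sup>n\<close> are irrelevant.
\<close>

definition holomorphic_germ :: "nat \<Rightarrow> ((nat \<Rightarrow> complex) \<Rightarrow> complex) \<Rightarrow> bool" where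
  "holomorphic_germ n f \<longleftrightarrow>
     (\<exists>U. open_nbhd0 n U \<and> holomorphic_Cn n f U) \<and> f (\<lambda>_. 0) = 0"

definition germ_eq ::
    "nat \<Rightarrow> ((nat \<Rightarrow> complex) \<Rightarrow> complex) \<Rightarrow> ((nat \<Rightarrow> complex) \<Rightarrow> complex) \<Rightarrow> bool" where
  "germ_eq n f g \<longleftrightarrow> (\<exists>U. open_nbhd0 n U \<and> (\<forall>z\<in>U. f z = g z))"

definition local_biholomorphism :: "nat \<Rightarrow> ((nat \<Rightarrow> complex) \<Rightarrow> (nat \<Rightarrow> complex)) \<Rightarrow> bool" where
  "local_biholomorphism n \<phi> \<longleftrightarrow>
     \<phi> (\<lambda>_. 0) = (\<lambda>_. 0) \<and>
     (\<exists>U V. open_nbhd0 n U \<and> open_nbhd0 n V \<and> bij_betw \<phi> U V \<and>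
        holomorphic_map_Cn n \<phi> U \<and> holomorphic_map_Cn n (inv_into U \<phi>) V)"

definition right_equivalent ::
    "nat \<Rightarrow> ((nat \<Rightarrow> complex) \<Rightarrow> complex) \<Rightarrow> ((nat \<Rightarrow> complex) \<Rightarrow> complex) \<Rightarrow> bool" where
  "right_equivalent n f p \<longleftrightarrow> (\<exists>\<phi>. local_biholomorphism n \<phi> \<and> germ_eq n p (f \<circ> \<phi>))"

definition type_A :: "nat \<Rightarrow> nat \<Rightarrow> ((nat \<Rightarrow> complex) \<Rightarrow> complex) \<Rightarrow> bool" where
  "type_A n k f \<longleftrightarrow> right_equivalent n f (\<lambda>y. y 0 ^ (k + 1) + (\<Sum>i=1..<n. (y i)\<^sup>2))"


text \<open>
  A polynomial is the finitely supported map from monomials (exponent vectors) to coefficients.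
\<close>

type_synonym cpoly = "(nat \<Rightarrow>\<^sub>0 nat) \<Rightarrow>\<^sub>0 complex"

definition polys_in :: "nat \<Rightarrow> cpoly set" where
  "polys_in n = {p. \<forall>m \<in> Poly_Mapping.keys p. Poly_Mapping.keys m \<subseteq> {..<n}}"

definition poly_eval :: "cpoly \<Rightarrow> (nat \<Rightarrow> complex) \<Rightarrow> complex" where
  "poly_eval p z =
     (\<Sum>m \<in> Poly_Mapping.keys p. Poly_Mapping.lookup p m *
        (\<Prod>i \<in> Poly_Mapping.keys m. z i ^ Poly_Mapping.lookup m i))"

definition total_degree :: "cpoly \<Rightarrow> nat" where
  "total_degree p =
     Max (insert 0 ((\<lambda>m. \<Sum>i \<in> Poly_Mapping.keys m. Poly_Mapping.lookup m i) `
       Poly_Mapping.keys p))"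

text \<open>
  The infimum is taken in \<^typ>\<open>enat\<close>: it is a minimum whenever some polynomial is right equivalent
  to \<open>f\<close>, and is infinite otherwise. A finite upper bound thus includes the existence of such
  a polynomial.
\<close>

definition min_poly_degree :: "nat \<Rightarrow> ((nat \<Rightarrow> complex) \<Rightarrow> complex) \<Rightarrow> enat" where
  "min_poly_degree n f =
     (INF p \<in> {p \<in> polys_in n. right_equivalent n f (poly_eval p)}. enat (total_degree p))"

end

theory Submission
  imports Defs "HOL-Complex_Analysis.Cauchy_Integral_Formula"
begin

text \<open>
  Write \<open>k + 1 = \<Sum>i<n. a i * d ^ i\<close> in base \<open>d \<approx> root n k\<close>, with unbounded leading digit. The polynomial
  \<open>(\<Prod>i<n. z i ^ a i) + (\<Sum>i<n - 1. (z (i + 1) - z i ^ d)\<^sup>2)\<close>, whose degree is of order \<open>d\<close>, is of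
  type \<open>A\<^sub>k\<close>: on the curve where all \<open>u i = z (i + 1) - z i ^ d\<close> vanish the product is \<open>x ^ (k + 1)\<close>
  with \<open>x = z 0\<close>, and giving \<open>x\<close> the weight \<open>1\<close> and \<open>z i\<close> the weight \<open>d ^ i\<close> makes the product
  weighted homogeneous, so its part linear in \<open>u\<close> is divisible by \<open>x ^ s\<close> for \<open>s = k + 1 - d ^ (n - 1)\<close>.
  As \<open>2 * s > k + 1\<close>, completing the squares one variable at a time changes \<open>x ^ (k + 1)\<close> only by a
  unit, which is absorbed into \<open>x\<close> by a root. The new coordinates are tangent to the identity,
  hence a local biholomorphism by the inverse function theorem. This requires \<open>d \<ge> 2\<close>; otherwise
  \<open>k < 2 ^ n\<close> and the normal form itself has small enough degree.
\<close>

section \<open>The subspace topology and differentiability in terms of the norm\<close>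

text \<open>By Bezout, an isolated critical point of a polynomial of degree \<open>D\<close> has
  Milnor number at most \<open>(D - 1) ^ n\<close>, so the order \<open>root n k\<close> cannot be
  improved and every variable has to contribute. Each relation \<open>z (i + 1) = z i ^ d\<close>
  multiplies the order of vanishing along the curve by \<open>d\<close> and costs only a square of
  degree \<open>2 * d\<close>; the digits then hit the exponent \<open>k + 1\<close> exactly instead
  of only powers of \<open>d\<close>.

  The analytic obstacle is that holomorphy is given as pointwise Frechet differentiability. The new
  coordinates are built by sums, products, inverses and roots of germs, and strict differentiability
  near the origin is stable under all of these while being strong enough for inversion. The
  biholomorphism that comes with the type of \<open>f\<close> is known only to be Frechet
  differentiable, so both notions are carried along and meet only when coordinate changes are
  composed. No power series occur: the coefficients in the square completion are germs of functions,
  of which only regularity, values at the origin and some first-order data are recorded.\<close>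

abbreviation origin :: "nat \<Rightarrow> complex" where
  "origin \<equiv> \<lambda>_. 0"

definition cdist :: "nat \<Rightarrow> (nat \<Rightarrow> complex) \<Rightarrow> (nat \<Rightarrow> complex) \<Rightarrow> real" where
  "cdist n w z = cnorm n (\<lambda>i. w i - z i)"

definition linform :: "nat \<Rightarrow> (nat \<Rightarrow> complex) \<Rightarrow> (nat \<Rightarrow> complex) \<Rightarrow> complex" where
  "linform n c v = (\<Sum>i<n. c i * v i)"

text \<open>In contrast to \<open>at z within cspace n\<close>, the point \<open>z\<close> itself is
  not removed. Eventual statements therefore hold at \<open>z\<close>, and in a two-point estimate
  one of the points may be fixed at \<open>z\<close>.\<close>

definition cnhds :: "nat \<Rightarrow> (nat \<Rightarrow> complex) \<Rightarrow> (nat \<Rightarrow> complex) filter" where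
  "cnhds n z = inf (nhds z) (principal (cspace n))"

lemma origin_in_cspace [simp]: "origin \<in> cspace n"
  by (simp add: cspace_def)

lemma cspace_diff: "w \<in> cspace n \<Longrightarrow> z \<in> cspace n \<Longrightarrow> (\<lambda>i. w i - z i) \<in> cspace n"
  and cspace_add: "w \<in> cspace n \<Longrightarrow> z \<in> cspace n \<Longrightarrow> (\<lambda>i. w i + z i) \<in> cspace n"
  and cspace_scale: "w \<in> cspace n \<Longrightarrow> (\<lambda>i. a * w i) \<in> cspace n"
  by (auto simp: cspace_def)

lemma cspace_eqI: "w \<in> cspace n \<Longrightarrow> z \<in> cspace n \<Longrightarrow> (\<And>i. i < n \<Longrightarrow> w i = z i) \<Longrightarrow> w = z"
  by (rule ext) (simp add: cspace_def, metis not_le)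

lemma cnorm_nonneg [simp]: "0 \<le> cnorm n z"
  by (simp add: cnorm_def)

lemma cnorm_component_le: "i < n \<Longrightarrow> cmod (z i) \<le> cnorm n z"
  unfolding cnorm_def by (rule member_le_L2_set) auto

lemma cnorm_triangle: "cnorm n (\<lambda>i. v i + w i) \<le> cnorm n v + cnorm n w"
proof -
  have "cnorm n (\<lambda>i. v i + w i) \<le> L2_set (\<lambda>i. cmod (v i) + cmod (w i)) {..<n}"
    unfolding cnorm_def by (rule L2_set_mono) (auto simp: norm_triangle_ineq)
  also have "\<dots> \<le> cnorm n v + cnorm n w"
    unfolding cnorm_def by (rule L2_set_triangle_ineq)
  finally show ?thesis .
qed

lemma cnorm_scale: "cnorm n (\<lambda>i. a * v i) = cmod a * cnorm n v"
  unfolding cnorm_def by (simp add: norm_mult L2_set_right_distrib)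

lemma cnorm_le_sum: "cnorm n v \<le> (\<Sum>i<n. cmod (v i))"
  unfolding cnorm_def by (rule L2_set_le_sum) auto

lemma cnorm_le_bound:
  assumes "\<And>i. i < n \<Longrightarrow> cmod (v i) \<le> b"
  shows "cnorm n v \<le> real n * b"
proof -
  have "cnorm n v \<le> (\<Sum>i<n. cmod (v i))" by (rule cnorm_le_sum)
  also have "\<dots> \<le> (\<Sum>i<n. b)" by (rule sum_mono) (use assms in auto)
  finally show ?thesis by simp
qed

lemma cdist_nonneg [simp]: "0 \<le> cdist n w z"
  by (simp add: cdist_def)

lemma cdist_self [simp]: "cdist n z z = 0"
  by (simp add: cdist_def cnorm_def L2_set_def)

lemma cdist_origin [simp]: "cdist n z origin = cnorm n z"
  by (simp add: cdist_def)

lemma cdist_component_le: "i < n \<Longrightarrow> cmod (w i - z i) \<le> cdist n w z"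
  unfolding cdist_def using cnorm_component_le[of i n "\<lambda>i. w i - z i"] by simp

lemma cdist_commute: "cdist n w z = cdist n z w"
  unfolding cdist_def cnorm_def by (simp add: norm_minus_commute)

lemma cdist_triangle: "cdist n u w \<le> cdist n u v + cdist n v w"
  using cnorm_triangle[of n "\<lambda>i. u i - v i" "\<lambda>i. v i - w i"] by (simp add: cdist_def)

lemma cdist_eq_0: "w \<in> cspace n \<Longrightarrow> z \<in> cspace n \<Longrightarrow> cdist n w z = 0 \<Longrightarrow> w = z"
  by (rule cspace_eqI[of _ n]) (auto simp: cdist_def cnorm_def L2_set_eq_0_iff)

lemma cmod_linform_le: "cmod (linform n c v) \<le> (\<Sum>i<n. cmod (c i)) * cnorm n v"
proof -
  have "cmod (linform n c v) \<le> (\<Sum>i<n. cmod (c i) * cmod (v i))"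
    unfolding linform_def norm_mult[symmetric] by (rule norm_sum)
  also have "\<dots> \<le> (\<Sum>i<n. cmod (c i) * cnorm n v)"
    by (intro sum_mono mult_left_mono cnorm_component_le) auto
  finally show ?thesis by (simp add: sum_distrib_right)
qed

lemma linform_diff: "linform n c (\<lambda>i. v i - w i) = linform n c v - linform n c w"
  and linform_scale: "linform n c (\<lambda>i. a * v i) = a * linform n c v"
  by (simp_all add: linform_def right_diff_distrib sum_subtractf sum_distrib_left mult.left_commute)

text \<open>A basic open set of the product topology restricts each coordinate separately. Inside
  \<open>cspace n\<close> the coordinates from \<open>n\<close> on agree with those of
  \<open>z\<close>, so only \<open>n\<close> radii matter and their minimum works. Conversely,
  \<open>cdist\<close> depends continuously on finitely many coordinates, hence its balls are open
  in the whole product.\<close>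

lemma eventually_cnhds:
  assumes z: "z \<in> cspace n"
  shows "eventually P (cnhds n z) \<longleftrightarrow> (\<exists>r>0. \<forall>w\<in>cspace n. cdist n w z < r \<longrightarrow> P w)"
    (is "?L \<longleftrightarrow> ?R")
proof
  assume ?L
  then obtain S where S: "open S" "z \<in> S" and SP: "\<forall>w\<in>S. w \<in> cspace n \<longrightarrow> P w"
    unfolding cnhds_def eventually_inf_principal eventually_nhds
    by (elim exE conjE) (rule that)
  have "openin (product_topology (\<lambda>_. euclidean) UNIV) S"
    using S(1) by (simp only: open_fun_def)
  from product_topology_open_contains_basis[OF this S(2)]
  obtain X where X: "z \<in> Pi\<^sub>E UNIV X" "Pi\<^sub>E UNIV X \<subseteq> S"
    and Xo: "\<forall>i. openin euclidean (X i)"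
    by (elim exE conjE) (rule that)
  have Xo: "open (X i)" for i
    using Xo by (simp only: open_openin)
  have zX: "z i \<in> X i" for i
    using X(1) by (rule PiE_mem) simp
  have XS: "w \<in> S" if "\<And>i. w i \<in> X i" for w
    by (rule subsetD[OF X(2)]) (simp add: PiE_iff that)
  have "\<forall>i. \<exists>e>0. ball (z i) e \<subseteq> X i"
    using zX Xo open_contains_ball by blast
  then obtain e where e: "\<And>i. e i > 0" "\<And>i. ball (z i) (e i) \<subseteq> X i"
    by metis
  \<comment> \<open>The element \<open>1\<close> keeps the set nonempty in dimension
    \<open>n = 0\<close>.\<close>
  define r where "r = Min (insert 1 (e ` {..<n}))"
  have r: "r > 0" "\<And>i. i < n \<Longrightarrow> r \<le> e i"
    using e(1) by (auto simp: r_def)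
  have "P w" if w: "w \<in> cspace n" "cdist n w z < r" for w
  proof (rule SP[rule_format])
    have "w i \<in> X i" for i
    proof (cases "i < n")
      case True
      then have "cmod (w i - z i) < e i"
        using cdist_component_le[OF True, of w z] w r(2)[OF True] by linarith
      then show ?thesis using subsetD[OF e(2)[of i], of "w i"] by (simp add: dist_norm norm_minus_commute)
    next
      case False
      then have "w i = z i" using w(1) z by (simp add: cspace_def)
      then show ?thesis using zX[of i] by simp
    qed
    then show "w \<in> S" by (rule XS)
  qed (rule w(1))
  then show ?R using r(1) by (intro exI[of _ r]) simp
next
  assume ?R
  then obtain r where r: "r > 0" "\<And>w. w \<in> cspace n \<Longrightarrow> cdist n w z < r \<Longrightarrow> P w" by (elim exE conjE) (rule that, auto)
  have "open {w. cdist n w z < r}"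
    unfolding cdist_def cnorm_def L2_set_def
    by (intro open_Collect_less continuous_intros) simp_all
  then show ?L
    unfolding cnhds_def eventually_inf_principal eventually_nhds
    using r by (intro exI[of _ "{w. cdist n w z < r}"]) simp
qed

lemma openin_cspace_iff:
  "openin (top_of_set (cspace n)) U \<longleftrightarrow> U \<subseteq> cspace n \<and> (\<forall>z\<in>U. \<forall>\<^sub>F w in cnhds n z. w \<in> U)"
    (is "?L \<longleftrightarrow> ?R")
proof
  assume ?L
  then obtain T where T: "open T" "U = cspace n \<inter> T"
    unfolding openin_open by (elim exE conjE) (rule that)
  then show ?R
    unfolding cnhds_def eventually_inf_principal eventually_nhds
    by (intro conjI ballI exI[of _ T]) simp_all
next
  assume R: ?R
  show ?L
  proof (subst openin_subopen, intro ballI)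
    fix z assume z: "z \<in> U"
    with R have "\<forall>\<^sub>F w in cnhds n z. w \<in> U" "z \<in> cspace n" by (simp_all add: subset_iff)
    then obtain T where "open T" "z \<in> T" "\<forall>w\<in>T. w \<in> cspace n \<longrightarrow> w \<in> U"
      unfolding cnhds_def eventually_inf_principal eventually_nhds
      by (elim exE conjE) (rule that)
    with \<open>z \<in> cspace n\<close> show "\<exists>T. openin (top_of_set (cspace n)) T \<and> z \<in> T \<and> T \<subseteq> U"
      by (intro exI[of _ "cspace n \<inter> T"]) (simp add: openin_open_Int subset_iff)
  qed
qed

lemma eventually_in_cspace: "\<forall>\<^sub>F w in cnhds n z. w \<in> cspace n"
  by (simp add: cnhds_def eventually_inf_principal)

lemma openin_cball_cspace:
  "openin (top_of_set (cspace n)) {w \<in> cspace n. cdist n w z < r}"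
  unfolding openin_cspace_iff
proof (intro conjI ballI)
  fix w assume w: "w \<in> {w \<in> cspace n. cdist n w z < r}"
  have "cdist n v z < r" if "cdist n v w < r - cdist n w z" for v
    using cdist_triangle[of n v z w] that by linarith
  then show "\<forall>\<^sub>F v in cnhds n w. v \<in> {w \<in> cspace n. cdist n w z < r}"
    using w by (subst eventually_cnhds) (auto intro!: exI[of _ "r - cdist n w z"])
qed auto

lemma eventually_cnhds_open:
  assumes "z \<in> cspace n" "eventually P (cnhds n z)"
  obtains U where "openin (top_of_set (cspace n)) U" "z \<in> U" "\<And>w. w \<in> U \<Longrightarrow> P w"
proof -
  obtain r where r: "r > 0" "\<And>w. w \<in> cspace n \<Longrightarrow> cdist n w z < r \<Longrightarrow> P w"
    using assms(2) unfolding eventually_cnhds[OF assms(1)] by (elim exE conjE) (rule that, auto)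
  show thesis
    by (rule that[of "{w \<in> cspace n. cdist n w z < r}"])
      (use openin_cball_cspace r assms in auto)
qed

lemma eventually_cnhds_origin:
  "eventually P (cnhds n origin) \<longleftrightarrow> (\<exists>U. open_nbhd0 n U \<and> (\<forall>z\<in>U. P z))"
proof
  assume "eventually P (cnhds n origin)"
  then show "\<exists>U. open_nbhd0 n U \<and> (\<forall>z\<in>U. P z)"
    by (rule eventually_cnhds_open[OF origin_in_cspace]) (auto simp: open_nbhd0_def)
next
  assume "\<exists>U. open_nbhd0 n U \<and> (\<forall>z\<in>U. P z)"
  then show "eventually P (cnhds n origin)"
    unfolding open_nbhd0_def openin_cspace_iff by (blast intro: eventually_mono)
qed

lemma eventually_cnhds_self: "z \<in> cspace n \<Longrightarrow> eventually P (cnhds n z) \<Longrightarrow> P z"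
  by (auto simp: eventually_cnhds)

text \<open>Multiplying the difference quotient out makes the estimate true at \<open>w = z\<close>
  as well, so that the unpunctured filter can be used and divisions by the norm disappear from all
  later proofs.\<close>

lemma complex_differentiable_iff:
  assumes z: "z \<in> cspace n"
  shows "complex_differentiable n f z \<longleftrightarrow>
    (\<exists>c. \<forall>e>0. \<forall>\<^sub>F w in cnhds n z.
       cmod (f w - f z - linform n c (\<lambda>i. w i - z i)) \<le> e * cdist n w z)"
proof -
  have "((\<lambda>w. cmod (f w - f z - (\<Sum>i<n. c i * (w i - z i))) / cnorm n (\<lambda>i. w i - z i))
          \<longlongrightarrow> 0) (at z within cspace n) \<longleftrightarrow> (\<forall>e>0. \<forall>\<^sub>F w in cnhds n z.
       cmod (f w - f z - linform n c (\<lambda>i. w i - z i)) \<le> e * cdist n w z)" (is "?L \<longleftrightarrow> ?R") for c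
  proof
    assume L: ?L
    show ?R
    proof (intro allI impI)
      fix e :: real assume "e > 0"
      then have "\<forall>\<^sub>F w in cnhds n z. w \<noteq> z \<longrightarrow>
          cmod (f w - f z - linform n c (\<lambda>i. w i - z i)) / cdist n w z < e"
        using L unfolding tendsto_iff eventually_at_filter cnhds_def eventually_inf_principal
        by (auto simp: linform_def cdist_def elim!: eventually_mono)
      then show "\<forall>\<^sub>F w in cnhds n z.
          cmod (f w - f z - linform n c (\<lambda>i. w i - z i)) \<le> e * cdist n w z"
        using eventually_in_cspace
      proof eventually_elim
        case (elim w)
        show ?case
        proof (cases "w = z")
          case True
          then show ?thesis by (simp add: linform_def)
        next
          case False
          then have "cdist n w z > 0"
            using cdist_eq_0[OF elim(2) z] cdist_nonneg[of n w z] by linarith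
          then show ?thesis using elim False by (simp add: divide_simps mult.commute)
        qed
      qed
    qed
  next
    assume R: ?R
    show ?L
      unfolding tendsto_iff eventually_at_filter
    proof (intro allI impI)
      fix e :: real assume "e > 0"
      then have "\<forall>\<^sub>F w in cnhds n z.
          cmod (f w - f z - linform n c (\<lambda>i. w i - z i)) \<le> e / 2 * cdist n w z"
        using R half_gt_zero by blast
      then show "\<forall>\<^sub>F w in nhds z. w \<noteq> z \<longrightarrow> w \<in> cspace n \<longrightarrow>
         dist (cmod (f w - f z - (\<Sum>i<n. c i * (w i - z i))) / cnorm n (\<lambda>i. w i - z i)) 0 < e"
        unfolding cnhds_def eventually_inf_principal
      proof eventually_elim
        case (elim w)
        show ?case
        proof (intro impI)
          assume w: "w \<noteq> z" "w \<in> cspace n"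
          then have d: "cdist n w z > 0"
            using cdist_eq_0[OF w(2) z] cdist_nonneg[of n w z] by linarith
          then have "cmod (f w - f z - linform n c (\<lambda>i. w i - z i)) < e * cdist n w z"
            using elim w mult_pos_pos[OF \<open>e > 0\<close> d]
            unfolding times_divide_eq_left by linarith
          then show "dist (cmod (f w - f z - (\<Sum>i<n. c i * (w i - z i))) / cnorm n (\<lambda>i. w i - z i)) 0 < e"
            using d by (simp add: linform_def cdist_def divide_simps)
        qed
      qed
    qed
  qed
  then show ?thesis unfolding complex_differentiable_def by simp
qed

section \<open>Strict differentiability\<close>

text \<open>
  Strict differentiability at a point is what the contraction argument of the inverse function
  theorem needs; unlike continuity of the partial derivatives, it does not require
  Cauchy estimates in several variables.
\<close>

definition sdiff ::
    "nat \<Rightarrow> ((nat \<Rightarrow> complex) \<Rightarrow> complex) \<Rightarrow> (nat \<Rightarrow> complex) \<Rightarrow> (nat \<Rightarrow> complex) \<Rightarrow> bool" where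
  "sdiff n f z c \<longleftrightarrow> (\<forall>e>0. \<forall>\<^sub>F (w, v) in cnhds n z \<times>\<^sub>F cnhds n z.
     cmod (f w - f v - linform n c (\<lambda>i. w i - v i)) \<le> e * cdist n w v)"

text \<open>The contraction argument uses strict differentiability at the origin alone, but
  holomorphy of a map asks for a derivative at all points of a neighbourhood. Hence the condition is
  required at every nearby point.\<close>

definition sdiff_germ :: "nat \<Rightarrow> ((nat \<Rightarrow> complex) \<Rightarrow> complex) \<Rightarrow> bool" where
  "sdiff_germ n f \<longleftrightarrow> (\<forall>\<^sub>F z in cnhds n origin. \<exists>c. sdiff n f z c)"

lemma sdiffI:
  assumes "\<And>e. e > 0 \<Longrightarrow> \<forall>\<^sub>F (w, v) in cnhds n z \<times>\<^sub>F cnhds n z.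
     cmod (f w - f v - linform n c (\<lambda>i. w i - v i)) \<le> e * cdist n w v"
  shows "sdiff n f z c"
  using assms unfolding sdiff_def by blast

lemma sdiffD:
  assumes "sdiff n f z c" "e > 0"
  shows "\<forall>\<^sub>F p in cnhds n z \<times>\<^sub>F cnhds n z.
     cmod (f (fst p) - f (snd p) - linform n c (\<lambda>i. fst p i - snd p i)) \<le> e * cdist n (fst p) (snd p)"
  using assms unfolding sdiff_def case_prod_beta by blast

lemma eventually_fst: "eventually P F \<Longrightarrow> \<forall>\<^sub>F p in F \<times>\<^sub>F G. P (fst p)"
  and eventually_snd: "eventually P G \<Longrightarrow> \<forall>\<^sub>F p in F \<times>\<^sub>F G. P (snd p)"
  using filterlim_fst[of F G] filterlim_snd[of G F] by (auto simp: filterlim_iff)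

lemma linform_delta:
  assumes "i < n"
  shows "linform n (\<lambda>j. if j = i then 1 else 0) v = v i"
proof -
  have "linform n (\<lambda>j. if j = i then 1 else 0) v = (\<Sum>j<n. if j = i then v j else 0)"
    unfolding linform_def by (rule sum.cong) auto
  then show ?thesis using assms by simp
qed

lemma linform_zero [simp]: "linform n (\<lambda>_. 0) v = 0"
  by (simp add: linform_def)

lemma linform_add_coeff: "linform n (\<lambda>i. c i + d i) v = linform n c v + linform n d v"
  and linform_scale_coeff: "linform n (\<lambda>i. a * c i) v = a * linform n c v"
  by (simp_all add: linform_def distrib_right sum.distrib sum_distrib_left mult.assoc)

lemma cmod_linform_diff_le:
  "cmod (linform n c (\<lambda>i. w i - v i)) \<le> (\<Sum>i<n. cmod (c i)) * cdist n w v"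
  unfolding cdist_def by (rule cmod_linform_le)

lemma sdiff_lipschitz:
  assumes "sdiff n f z c"
  shows "\<forall>\<^sub>F p in cnhds n z \<times>\<^sub>F cnhds n z.
    cmod (f (fst p) - f (snd p)) \<le> (1 + (\<Sum>i<n. cmod (c i))) * cdist n (fst p) (snd p)"
  using sdiffD[OF assms zero_less_one]
proof eventually_elim
  case (elim p)
  then show ?case
    using norm_triangle_sub[of "f (fst p) - f (snd p)" "linform n c (\<lambda>i. fst p i - snd p i)"]
      cmod_linform_diff_le[of n c "fst p" "snd p"]
    unfolding distrib_right by linarith
qed

lemma eventually_pair_fix:
  assumes "z \<in> cspace n" "eventually P (cnhds n z \<times>\<^sub>F cnhds n z)"
  shows "\<forall>\<^sub>F w in cnhds n z. P (w, z)"
proof -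
  from assms(2) obtain Q where Q: "eventually Q (cnhds n z)"
    "\<And>x y. Q x \<Longrightarrow> Q y \<Longrightarrow> P (x, y)"
    unfolding eventually_prod_same by metis
  show ?thesis
    using Q(1) by (rule eventually_mono) (rule Q(2)[OF _ eventually_cnhds_self[OF assms(1) Q(1)]])
qed

lemma tendsto_cdist:
  assumes "z \<in> cspace n"
  shows "((\<lambda>w. cdist n w z) \<longlongrightarrow> 0) (cnhds n z)"
  unfolding tendsto_iff
proof (intro allI impI)
  fix e :: real assume "e > 0"
  then show "\<forall>\<^sub>F w in cnhds n z. dist (cdist n w z) 0 < e"
    by (subst eventually_cnhds[OF assms]) auto
qed

lemma sdiff_tendsto:
  assumes z: "z \<in> cspace n" and f: "sdiff n f z c"
  shows "(f \<longlongrightarrow> f z) (cnhds n z)"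
proof -
  let ?K = "1 + (\<Sum>i<n. cmod (c i))"
  have "((\<lambda>w. f w - f z) \<longlongrightarrow> 0) (cnhds n z)"
  proof (rule Lim_null_comparison)
    show "\<forall>\<^sub>F w in cnhds n z. norm (f w - f z) \<le> ?K * cdist n w z"
      using eventually_pair_fix[OF z sdiff_lipschitz[OF f]] by simp
    show "((\<lambda>w. ?K * cdist n w z) \<longlongrightarrow> 0) (cnhds n z)"
      using tendsto_mult_right_zero[OF tendsto_cdist[OF z]] .
  qed
  then show ?thesis by (simp add: LIM_zero_iff)
qed

lemma sdiff_imp_complex_differentiable:
  assumes z: "z \<in> cspace n" and f: "sdiff n f z c"
  shows "complex_differentiable n f z"
  unfolding complex_differentiable_iff[OF z]
  using eventually_pair_fix[OF z sdiffD[OF f]] by auto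

lemma sdiff_const: "sdiff n (\<lambda>_. a) z (\<lambda>_. 0)"
  by (rule sdiffI) (auto simp: case_prod_unfold)

lemma sdiff_coord: "i < n \<Longrightarrow> sdiff n (\<lambda>w. w i) z (\<lambda>j. if j = i then 1 else 0)"
  by (rule sdiffI) (auto simp: case_prod_unfold linform_delta)

lemma sdiff_add:
  assumes "sdiff n f z c" "sdiff n g z d"
  shows "sdiff n (\<lambda>w. f w + g w) z (\<lambda>i. c i + d i)"
proof (rule sdiffI, unfold case_prod_unfold)
  fix e :: real assume "e > 0"
  then have "e / 2 > 0" by simp
  show "\<forall>\<^sub>F p in cnhds n z \<times>\<^sub>F cnhds n z.
     cmod (f (fst p) + g (fst p) - (f (snd p) + g (snd p)) -
       linform n (\<lambda>i. c i + d i) (\<lambda>i. fst p i - snd p i)) \<le> e * cdist n (fst p) (snd p)"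
    using sdiffD[OF assms(1) \<open>e / 2 > 0\<close>] sdiffD[OF assms(2) \<open>e / 2 > 0\<close>]
  proof eventually_elim
    case (elim p)
    have *: "f (fst p) + g (fst p) - (f (snd p) + g (snd p)) -
       linform n (\<lambda>i. c i + d i) (\<lambda>i. fst p i - snd p i) =
      (f (fst p) - f (snd p) - linform n c (\<lambda>i. fst p i - snd p i)) +
      (g (fst p) - g (snd p) - linform n d (\<lambda>i. fst p i - snd p i))"
      by (simp add: linform_add_coeff)
    show ?case
      unfolding * by (rule norm_triangle_le) (use add_mono[OF elim] in simp)
  qed
qed

lemma sdiff_mult:
  assumes z: "z \<in> cspace n" and f: "sdiff n f z c" and g: "sdiff n g z d"
  shows "sdiff n (\<lambda>w. f w * g w) z (\<lambda>i. f z * d i + g z * c i)"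
proof (rule sdiffI, unfold case_prod_unfold)
  fix e :: real assume e: "e > 0"
  define C where "C = (\<Sum>i<n. cmod (c i))"
  define D where "D = (\<Sum>i<n. cmod (d i))"
  \<comment> \<open>\<open>B\<close> collects the coefficients of \<open>q * cdist n w v\<close> in
    the four estimates below: \<open>cmod (f z) + 1\<close> and \<open>cmod (g z) + 1\<close> bound
    the moving factors, \<open>C\<close> and \<open>D\<close> bound the two linear forms. With
    \<open>q = e / B\<close> the total is exactly \<open>e\<close>.\<close>
  define B where "B = cmod (f z) + cmod (g z) + 2 + C + D"
  define q where "q = e / B"
  have CD: "C \<ge> 0" "D \<ge> 0" by (auto simp: C_def D_def intro: sum_nonneg)
  then have B: "B > 0" unfolding B_def by (smt (verit) norm_ge_zero)
  then have q: "q > 0" "q * B = e" using e by (auto simp: q_def)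
  have near: "\<forall>\<^sub>F w in cnhds n z. cmod (h w - h z) < r" if "sdiff n h z b" "r > 0" for h b r
    using sdiff_tendsto[OF z that(1)] that(2) unfolding tendsto_iff dist_norm by blast
  show "\<forall>\<^sub>F p in cnhds n z \<times>\<^sub>F cnhds n z.
     cmod (f (fst p) * g (fst p) - f (snd p) * g (snd p) -
       linform n (\<lambda>i. f z * d i + g z * c i) (\<lambda>i. fst p i - snd p i)) \<le> e * cdist n (fst p) (snd p)"
    using sdiffD[OF f q(1)] sdiffD[OF g q(1)]
      eventually_fst[OF near[OF f q(1)]] eventually_fst[OF near[OF f zero_less_one]]
      eventually_snd[OF near[OF g q(1)]] eventually_snd[OF near[OF g zero_less_one]]
  proof eventually_elim
    case (elim p)
    obtain w v where p: "p = (w, v)" by (cases p)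
    let ?\<delta> = "cdist n w v"
    let ?lc = "linform n c (\<lambda>i. w i - v i)" and ?ld = "linform n d (\<lambda>i. w i - v i)"
    \<comment> \<open>Each summand pairs a bounded factor with a small one: either a linearization
      error, or the distance of a factor from its value at \<open>z\<close>.\<close>
    have *: "f w * g w - f v * g v - linform n (\<lambda>i. f z * d i + g z * c i) (\<lambda>i. w i - v i) =
      f w * (g w - g v - ?ld) + (f w - f z) * ?ld + (g v * (f w - f v - ?lc) + (g v - g z) * ?lc)"
      unfolding linform_add_coeff linform_scale_coeff by (simp add: algebra_simps)
    have 1: "cmod (f w) \<le> cmod (f z) + 1"
      using elim(4) norm_triangle_ineq2[of "f w" "f z"] p by auto
    have 2: "cmod (g v) \<le> cmod (g z) + 1"
      using elim(6) norm_triangle_ineq2[of "g v" "g z"] p by auto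
    have "cmod (f w * (g w - g v - ?ld)) \<le> (cmod (f z) + 1) * (q * ?\<delta>)"
      unfolding norm_mult using elim(2) 1 q by (intro mult_mono) (auto simp: p)
    moreover have "cmod ((f w - f z) * ?ld) \<le> q * (D * ?\<delta>)"
      unfolding norm_mult D_def using elim(3) q cmod_linform_diff_le[of n d w v]
      by (intro mult_mono) (auto simp: p)
    moreover have "cmod (g v * (f w - f v - ?lc)) \<le> (cmod (g z) + 1) * (q * ?\<delta>)"
      unfolding norm_mult using elim(1) 2 q by (intro mult_mono) (auto simp: p)
    moreover have "cmod ((g v - g z) * ?lc) \<le> q * (C * ?\<delta>)"
      unfolding norm_mult C_def using elim(5) q cmod_linform_diff_le[of n c w v]
      by (intro mult_mono) (auto simp: p)
    ultimately have "cmod (f w * g w - f v * g v - linform n (\<lambda>i. f z * d i + g z * c i) (\<lambda>i. w i - v i))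
       \<le> (cmod (f z) + 1) * (q * ?\<delta>) + q * (D * ?\<delta>) + ((cmod (g z) + 1) * (q * ?\<delta>) + q * (C * ?\<delta>))"
      unfolding * by (intro norm_triangle_le add_mono)
    also have "\<dots> = q * B * ?\<delta>" by (simp add: B_def algebra_simps)
    finally show ?case using q by (simp add: p)
  qed
qed

section \<open>Composition with holomorphic functions of one variable: inverses and roots\<close>

text \<open>In one variable the derivative of a holomorphic function is continuous. The mean value
  inequality for \<open>h\<close> minus its linear part at \<open>a\<close>, on a ball where
  \<open>deriv h\<close> stays within \<open>e\<close> of \<open>deriv h a\<close>, gives the
  two-point estimate.\<close>

lemma holomorphic_strict_derivative:
  assumes h: "h holomorphic_on S" and S: "open S" "a \<in> S" and e: "e > 0"
  shows "\<forall>\<^sub>F p in nhds a \<times>\<^sub>F nhds a.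
    cmod (h (fst p) - h (snd p) - deriv h a * (fst p - snd p)) \<le> e * cmod (fst p - snd p)"
proof -
  have "isCont (deriv h) a"
    using holomorphic_on_imp_continuous_on[OF holomorphic_deriv[OF h S(1)]] S
    by (simp add: continuous_on_eq_continuous_at)
  then have "\<forall>\<^sub>F x in nhds a. dist (deriv h x) (deriv h a) < e"
    using e unfolding isCont_def tendsto_iff eventually_at_filter
    by (auto elim!: eventually_mono)
  moreover have "\<forall>\<^sub>F x in nhds a. x \<in> S" using S by (rule eventually_nhds_in_open)
  ultimately have "\<forall>\<^sub>F x in nhds a. dist (deriv h x) (deriv h a) < e \<and> x \<in> S"
    by (rule eventually_conj)
  then obtain r where r: "r > 0" "\<And>x. dist x a < r \<Longrightarrow> dist (deriv h x) (deriv h a) < e \<and> x \<in> S"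
    unfolding eventually_nhds_metric by blast
  have bound: "cmod (h x - h y - deriv h a * (x - y)) \<le> e * cmod (x - y)"
    if "x \<in> ball a r" "y \<in> ball a r" for x y
  proof -
    have "cmod ((h x - deriv h a * x) - (h y - deriv h a * y)) \<le> e * cmod (x - y)"
    proof (rule field_differentiable_bound[OF convex_ball _ _ that])
      fix u assume "u \<in> ball a r"
      then have u: "dist (deriv h u) (deriv h a) < e" "u \<in> S"
        using r(2)[of u] by (auto simp: dist_commute)
      have "(h has_field_derivative deriv h u) (at u)"
        using holomorphic_derivI[OF h S(1) u(2)] .
      then show "((\<lambda>x. h x - deriv h a * x) has_field_derivative deriv h u - deriv h a) (at u within ball a r)"
        by (intro has_field_derivative_at_within[OF DERIV_diff[OF _ DERIV_cmult_Id]])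
      show "norm (deriv h u - deriv h a) \<le> e"
        using u(1) by (simp add: dist_norm)
    qed
    then show ?thesis by (simp add: algebra_simps)
  qed
  have "\<forall>\<^sub>F x in nhds a. x \<in> ball a r"
    using r by (intro eventually_nhds_in_open) auto
  from eventually_fst[OF this] eventually_snd[OF this]
  show ?thesis by eventually_elim (rule bound)
qed

lemma sdiff_compose:
  assumes z: "z \<in> cspace n" and f: "sdiff n f z c"
    and h: "h holomorphic_on S" "open S" "f z \<in> S"
  shows "sdiff n (\<lambda>w. h (f w)) z (\<lambda>i. deriv h (f z) * c i)"
proof (rule sdiffI, unfold case_prod_unfold)
  fix e :: real assume e: "e > 0"
  define K where "K = 1 + (\<Sum>i<n. cmod (c i))"
  define b where "b = cmod (deriv h (f z)) + 1"
  have K: "K > 0" unfolding K_def by (smt (verit) norm_ge_zero sum_nonneg)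
  have b: "b > 0" unfolding b_def by (smt (verit) norm_ge_zero)
  have e1: "e / (2 * K) > 0" and e2: "e / (2 * b) > 0" using e K b by auto
  \<comment> \<open>Both points of a pair are carried by \<open>f\<close> towards
    \<open>f z\<close>, so the two-point estimate for \<open>h\<close> can be pulled back.\<close>
  have lim: "filterlim (\<lambda>p. (f (fst p), f (snd p))) (nhds (f z) \<times>\<^sub>F nhds (f z)) (cnhds n z \<times>\<^sub>F cnhds n z)"
    by (intro filterlim_Pair filterlim_compose[OF sdiff_tendsto[OF z f]] filterlim_fst filterlim_snd)
  have "\<forall>\<^sub>F p in cnhds n z \<times>\<^sub>F cnhds n z. cmod (h (f (fst p)) - h (f (snd p)) -
      deriv h (f z) * (f (fst p) - f (snd p))) \<le> e / (2 * K) * cmod (f (fst p) - f (snd p))"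
    using eventually_compose_filterlim[OF holomorphic_strict_derivative[OF h e1] lim] by simp
  with sdiff_lipschitz[OF f, folded K_def] sdiffD[OF f e2]
  show "\<forall>\<^sub>F p in cnhds n z \<times>\<^sub>F cnhds n z. cmod (h (f (fst p)) - h (f (snd p)) -
      linform n (\<lambda>i. deriv h (f z) * c i) (\<lambda>i. fst p i - snd p i)) \<le> e * cdist n (fst p) (snd p)"
  proof eventually_elim
    case (elim p)
    obtain w v where p: "p = (w, v)" by (cases p)
    let ?l = "linform n c (\<lambda>i. w i - v i)" and ?h = "deriv h (f z)"
    have *: "h (f w) - h (f v) - linform n (\<lambda>i. ?h * c i) (\<lambda>i. w i - v i) =
       (h (f w) - h (f v) - ?h * (f w - f v)) + ?h * (f w - f v - ?l)"
      unfolding linform_scale_coeff by (simp add: algebra_simps)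
    have "cmod (h (f w) - h (f v) - ?h * (f w - f v)) \<le> e / (2 * K) * (K * cdist n w v)"
      using elim(3) mult_left_mono[OF elim(1), of "e / (2 * K)"] e1 by (simp add: p)
    also have "\<dots> = e / 2 * cdist n w v" using K by simp
    finally have 1: "cmod (h (f w) - h (f v) - ?h * (f w - f v)) \<le> e / 2 * cdist n w v" .
    have "cmod (?h * (f w - f v - ?l)) \<le> b * (e / (2 * b) * cdist n w v)"
      unfolding norm_mult using elim(2) b by (intro mult_mono) (auto simp: p b_def)
    also have "\<dots> = e / 2 * cdist n w v" using b by simp
    finally have "cmod (?h * (f w - f v - ?l)) \<le> e / 2 * cdist n w v" .
    with 1 show ?case
      unfolding p fst_conv snd_conv * by (intro norm_triangle_le) simp
  qed
qed

lemma sdiff_germ_origin: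
  assumes "sdiff_germ n f"
  obtains c where "sdiff n f origin c"
  using eventually_cnhds_self[OF origin_in_cspace assms[unfolded sdiff_germ_def]] by blast

lemma sdiff_germ_const [intro]: "sdiff_germ n (\<lambda>_. a)"
  unfolding sdiff_germ_def using sdiff_const by (intro always_eventually) blast

lemma sdiff_germ_coord: "i < n \<Longrightarrow> sdiff_germ n (\<lambda>w. w i)"
  unfolding sdiff_germ_def using sdiff_coord by (intro always_eventually) blast

lemma sdiff_germ_add [intro]:
  assumes "sdiff_germ n f" "sdiff_germ n g"
  shows "sdiff_germ n (\<lambda>w. f w + g w)"
  using assms unfolding sdiff_germ_def by eventually_elim (blast intro: sdiff_add)

lemma sdiff_germ_mult [intro]:
  assumes "sdiff_germ n f" "sdiff_germ n g"
  shows "sdiff_germ n (\<lambda>w. f w * g w)"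
  using assms[unfolded sdiff_germ_def] eventually_in_cspace[of n origin]
  unfolding sdiff_germ_def by eventually_elim (blast intro: sdiff_mult)

lemma sdiff_germ_diff [intro]:
  assumes "sdiff_germ n f" "sdiff_germ n g"
  shows "sdiff_germ n (\<lambda>w. f w - g w)"
  using sdiff_germ_add[OF assms(1) sdiff_germ_mult[OF sdiff_germ_const[of n "-1"] assms(2)]] by simp

lemma sdiff_germ_power [intro]: "sdiff_germ n f \<Longrightarrow> sdiff_germ n (\<lambda>w. f w ^ k)"
  by (induction k) auto

lemma sdiff_germ_sum [intro]:
  "(\<And>i. i \<in> I \<Longrightarrow> sdiff_germ n (f i)) \<Longrightarrow> sdiff_germ n (\<lambda>w. \<Sum>i\<in>I. f i w)"
  by (induction I rule: infinite_finite_induct) auto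

lemma sdiff_germ_compose:
  assumes f: "sdiff_germ n f" and h: "h holomorphic_on S" "open S" "f origin \<in> S"
  shows "sdiff_germ n (\<lambda>w. h (f w))"
proof -
  obtain c where "sdiff n f origin c" using f by (rule sdiff_germ_origin)
  then have "(f \<longlongrightarrow> f origin) (cnhds n origin)"
    by (rule sdiff_tendsto[OF origin_in_cspace])
  then have "\<forall>\<^sub>F w in cnhds n origin. f w \<in> S"
    using h by (auto simp: tendsto_def)
  with f[unfolded sdiff_germ_def] eventually_in_cspace[of n origin]
  show ?thesis
    unfolding sdiff_germ_def by eventually_elim (use sdiff_compose h in blast)
qed

lemma sdiff_germ_eventually_nonzero:
  assumes f: "sdiff_germ n f" "f origin \<noteq> 0"
  shows "\<forall>\<^sub>F w in cnhds n origin. f w \<noteq> 0"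
proof -
  obtain c where "sdiff n f origin c" using f(1) by (rule sdiff_germ_origin)
  then have "(f \<longlongrightarrow> f origin) (cnhds n origin)"
    by (rule sdiff_tendsto[OF origin_in_cspace])
  then show ?thesis using f(2) by (rule tendsto_imp_eventually_ne)
qed

lemma sdiff_germ_inverse:
  assumes "sdiff_germ n f" "f origin \<noteq> 0"
  shows "sdiff_germ n (\<lambda>w. inverse (f w))"
  by (rule sdiff_germ_compose[OF assms(1), where S = "- {0}"])
    (use assms in \<open>auto intro!: holomorphic_intros\<close>)

text \<open>The value \<open>1\<close> lies off the cut of the principal logarithm, so the root is
  an exponential of \<open>Ln\<close>. Normalizing the root to \<open>1\<close> at the origin
  ensures that multiplying a coordinate by it does not change the differential there.\<close>

lemma sdiff_germ_root:
  assumes f: "sdiff_germ n f" "f origin = 1" and k: "k > 0"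
  obtains g where "sdiff_germ n g" "g origin = 1" "\<forall>\<^sub>F w in cnhds n origin. g w ^ k = f w"
proof
  let ?g = "\<lambda>w. exp (Ln (f w) / of_nat k)"
  show "sdiff_germ n ?g"
    by (rule sdiff_germ_compose[OF f(1), where S = "- \<real>\<^sub>\<le>\<^sub>0"])
      (use f k in \<open>auto intro!: holomorphic_intros\<close>)
  show "?g origin = 1" using f by simp
  show "\<forall>\<^sub>F w in cnhds n origin. ?g w ^ k = f w"
    using sdiff_germ_eventually_nonzero[OF f(1)] f(2)
    by (auto elim!: eventually_mono simp: exp_of_nat_mult[symmetric] k)
qed

text \<open>A product of two vanishing germs is of second order. Together with the rule for unit
  factors this shows that completing squares leaves the differentials of the coordinates at the
  origin unchanged.\<close>

lemma sdiff_mult_zero: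
  assumes "sdiff_germ n f" "f origin = 0" "sdiff_germ n g" "g origin = 0"
  shows "sdiff n (\<lambda>w. f w * g w) origin (\<lambda>_. 0)"
proof -
  obtain c d where "sdiff n f origin c" "sdiff n g origin d"
    using assms sdiff_germ_origin by metis
  from sdiff_mult[OF origin_in_cspace this] show ?thesis using assms by simp
qed

lemma sdiff_mult_unit:
  assumes "sdiff n f origin c" "f origin = 0" "sdiff_germ n g" "g origin = 1"
  shows "sdiff n (\<lambda>w. f w * g w) origin c"
proof -
  obtain d where "sdiff n g origin d"
    using assms sdiff_germ_origin by metis
  from sdiff_mult[OF origin_in_cspace assms(1) this] show ?thesis using assms by simp
qed

section \<open>Diagonalizing the quadratic part\<close>

lemma sdiff_sum_zero:
  assumes "\<And>i. i \<in> I \<Longrightarrow> sdiff n (f i) origin (\<lambda>_. 0)"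
  shows "sdiff n (\<lambda>w. \<Sum>i\<in>I. f i w) origin (\<lambda>_. 0)"
  using assms
proof (induction I rule: infinite_finite_induct)
  case (insert i I)
  then have "sdiff n (\<lambda>w. f i w + (\<Sum>i\<in>I. f i w)) origin (\<lambda>_. 0 + 0)"
    by (intro sdiff_add) auto
  then show ?case using insert by simp
qed (auto intro: sdiff_const)

text \<open>The shape with a unit \<open>E\<close> and coefficient germs \<open>h\<close>,
  \<open>g\<close> is chosen because it is reproduced when one \<open>u j\<close> is eliminated. The
  condition \<open>N < 2 * s\<close> lets the resulting term in \<open>x ^ (2 * s)\<close> be
  absorbed into \<open>E\<close> without changing its value at the origin, and
  \<open>s \<ge> 2\<close> makes the linear terms too small to affect differentials.
  \<open>Q\<close> is an arbitrary function since the induction hypothesis is applied to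
  \<open>Q\<close> minus a square. The differentials \<open>cx\<close> and \<open>c i\<close> are
  carried through so that the final map can be inverted.\<close>

lemma diagonalize_quadratic:
  fixes x :: "(nat \<Rightarrow> complex) \<Rightarrow> complex" and u :: "nat \<Rightarrow> (nat \<Rightarrow> complex) \<Rightarrow> complex"
  assumes x: "sdiff n x origin cx" "sdiff_germ n x" "x origin = 0"
    and N: "N > 0" "N < 2 * s" "s \<ge> 2"
  assumes "\<And>i. i < j \<Longrightarrow> sdiff_germ n (u i)" "\<And>i. i < j \<Longrightarrow> u i origin = 0"
    "\<And>i. i < j \<Longrightarrow> sdiff n (u i) origin (c i)"
    "sdiff_germ n E" "E origin = 1"
    "\<And>i. sdiff_germ n (h i)" "\<And>i l. sdiff_germ n (g i l)" "\<And>i l. g i l origin = 0"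
    "\<forall>\<^sub>F z in cnhds n origin. Q z = x z ^ N * E z + (\<Sum>i<j. x z ^ s * h i z * u i z) +
       (\<Sum>i<j. \<Sum>l<j. g i l z * u i z * u l z) + (\<Sum>i<j. (u i z)\<^sup>2)"
  shows "\<exists>X U. sdiff_germ n X \<and> X origin = 0 \<and> sdiff n X origin cx \<and>
    (\<forall>i<j. sdiff_germ n (U i) \<and> U i origin = 0 \<and> sdiff n (U i) origin (c i)) \<and>
    (\<forall>\<^sub>F z in cnhds n origin. Q z = X z ^ N + (\<Sum>i<j. (U i z)\<^sup>2))"
  using assms(7-)
proof (induction j arbitrary: E h g Q)
  case 0
  obtain R where R: "sdiff_germ n R" "R origin = 1" "\<forall>\<^sub>F w in cnhds n origin. R w ^ N = E w"
    using sdiff_germ_root[OF 0(4,5) N(1)] by blast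
  have "\<forall>\<^sub>F z in cnhds n origin. Q z = (x z * R z) ^ N"
    using 0(9) R(3) by eventually_elim (simp add: power_mult_distrib)
  then show ?case
    using R x by (intro exI[of _ "\<lambda>z. x z * R z"]) (auto intro: sdiff_mult_unit)
next
  case (Suc j)
  note u = Suc.prems(1,2,3) and E = Suc.prems(4,5) and h = Suc.prems(6)
    and g = Suc.prems(7,8) and Q = Suc.prems(9)
  txt \<open>
    The terms containing \<open>u j\<close> are \<open>A (u j)\<^sup>2 + L (u j) = A (u j + L / (2 A))\<^sup>2 - L\<^sup>2 / (4 A)\<close>, and
    \<open>L\<^sup>2 / (4 A)\<close> again has the shape of the remaining terms.
  \<close>
  define A where "A = (\<lambda>z. 1 + g j j z)"
  define B where "B = (\<lambda>z. inverse (A z))"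
  have A: "sdiff_germ n A" "A origin = 1" unfolding A_def using g by auto
  have A0: "\<forall>\<^sub>F z in cnhds n origin. A z \<noteq> 0"
    using sdiff_germ_eventually_nonzero[OF A(1)] A(2) by simp
  have B: "sdiff_germ n B" "B origin = 1"
    unfolding B_def using sdiff_germ_inverse[OF A(1)] A(2) by auto
  obtain R where R: "sdiff_germ n R" "R origin = 1" "\<forall>\<^sub>F z in cnhds n origin. R z ^ 2 = A z"
    using sdiff_germ_root[OF A, of 2] by auto
  \<comment> \<open>The family \<open>g\<close> need not be symmetric, so both mixed coefficients of
    \<open>u j\<close> and \<open>u l\<close> are added.\<close>
  define T where "T = (\<lambda>z. \<Sum>l<j. (g l j z + g j l z) * u l z)"
  define L where "L = (\<lambda>z. x z ^ s * h j z + T z)"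
  define V where "V = (\<lambda>z. (u j z + L z * (B z * (1/2))) * R z)"
  \<comment> \<open>With \<open>L = x ^ s * h j + T\<close>, the three parts of
    \<open>L\<^sup>2 / (4 A)\<close> are distributed: the square of the first summand goes into the
    unit, as \<open>x ^ (2 * s) = x ^ N * x ^ (2 * s - N)\<close>; the mixed term corrects the
    linear coefficients \<open>h'\<close>; and \<open>T\<^sup>2\<close> corrects the quadratic
    coefficients \<open>g'\<close>.\<close>
  define E' where "E' = (\<lambda>z. E z - x z ^ (2 * s - N) * (h j z * h j z) * (B z * (1/4)))"
  define h' where "h' = (\<lambda>i z. h i z - h j z * ((g i j z + g j i z) * (B z * (1/2))))"
  define g' where "g' = (\<lambda>i l z. g i l z - (g i j z + g j i z) * ((g l j z + g j l z) * (B z * (1/4))))"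
  have T: "sdiff_germ n T"
    unfolding T_def using u g by (intro sdiff_germ_sum sdiff_germ_mult sdiff_germ_add) auto
  have L: "sdiff_germ n L"
    unfolding L_def by (intro sdiff_germ_mult sdiff_germ_add sdiff_germ_power x h T)
  have L0: "L origin = 0"
    unfolding L_def T_def using x N g by simp
  \<comment> \<open>After splitting off one \<open>x\<close>, the bound \<open>s \<ge> 2\<close>
    leaves a second factor that still vanishes at the origin.\<close>
  have "sdiff n (\<lambda>z. x z * (x z ^ (s - 1) * h j z)) origin (\<lambda>_. 0)"
    by (rule sdiff_mult_zero) (use x N h in \<open>auto intro!: sdiff_germ_mult sdiff_germ_power\<close>)
  moreover have "x z * (x z ^ (s - 1) * h j z) = x z ^ s * h j z" for z
    using N by (simp add: power_eq_if)
  ultimately have "sdiff n (\<lambda>z. x z ^ s * h j z) origin (\<lambda>_. 0)" by (simp only:)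
  moreover have "sdiff n T origin (\<lambda>_. 0)"
    unfolding T_def by (intro sdiff_sum_zero sdiff_mult_zero) (use u g in auto)
  ultimately have "sdiff n L origin (\<lambda>_. 0)"
    unfolding L_def using sdiff_add by fastforce
  moreover have Bh: "sdiff_germ n (\<lambda>z. B z * (1/2))" "sdiff_germ n (\<lambda>z. B z * (1/4))"
    by (intro sdiff_germ_mult B sdiff_germ_const)+
  obtain d where "sdiff n (\<lambda>z. B z * (1/2)) origin d"
    using sdiff_germ_origin[OF Bh(1)] by blast
  ultimately have "sdiff n (\<lambda>z. L z * (B z * (1/2))) origin (\<lambda>_. 0)"
    using sdiff_mult[OF origin_in_cspace, of n L "\<lambda>_. 0" "\<lambda>z. B z * (1/2)" d] L0 by simp
  then have "sdiff n (\<lambda>z. u j z + L z * (B z * (1/2))) origin (\<lambda>i. c j i + 0)"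
    using u by (intro sdiff_add) auto
  then have V3: "sdiff n V origin (c j)"
    unfolding V_def using R L0 u by (intro sdiff_mult_unit) auto
  have V1: "sdiff_germ n V"
    unfolding V_def using u by (intro sdiff_germ_mult sdiff_germ_add R L Bh) auto
  have V2: "V origin = 0"
    unfolding V_def using L0 u by simp
  have "\<exists>X U. sdiff_germ n X \<and> X origin = 0 \<and> sdiff n X origin cx \<and>
    (\<forall>i<j. sdiff_germ n (U i) \<and> U i origin = 0 \<and> sdiff n (U i) origin (c i)) \<and>
    (\<forall>\<^sub>F z in cnhds n origin. Q z - (V z)\<^sup>2 = X z ^ N + (\<Sum>i<j. (U i z)\<^sup>2))"
  proof (rule Suc.IH)
    show "sdiff_germ n E'"
      unfolding E'_def by (intro sdiff_germ_diff sdiff_germ_mult sdiff_germ_power x h E Bh)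
    show "E' origin = 1" unfolding E'_def using x N E by simp
    show "sdiff_germ n (h' i)" for i
      unfolding h'_def by (intro sdiff_germ_diff sdiff_germ_add sdiff_germ_mult h g Bh)
    show "sdiff_germ n (g' i l)" for i l
      unfolding g'_def
      by (intro sdiff_germ_diff sdiff_germ_add sdiff_germ_mult g(1) B sdiff_germ_const)
    show "g' i l origin = 0" for i l
      unfolding g'_def by (simp add: g)
    show "\<forall>\<^sub>F z in cnhds n origin. Q z - (V z)\<^sup>2 =
      x z ^ N * E' z + (\<Sum>i<j. x z ^ s * h' i z * u i z) +
       (\<Sum>i<j. \<Sum>l<j. g' i l z * u i z * u l z) + (\<Sum>i<j. (u i z)\<^sup>2)"
      using Q R(3) A0
    proof eventually_elim
      case (elim z)
      let ?b = "B z" and ?v = "u j z" and ?y = "x z ^ s * h j z"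
      define H where "H = (\<Sum>i<j. x z ^ s * h i z * u i z)"
      define K where "K = (\<Sum>i<j. \<Sum>l<j. g i l z * u i z * u l z)"
      define S where "S = (\<Sum>i<j. (u i z)\<^sup>2)"
      have AB: "A z * ?b = 1" using elim by (simp add: B_def)
      have "(\<Sum>i<Suc j. \<Sum>l<Suc j. g i l z * u i z * u l z) =
          K + ((\<Sum>i<j. g i j z * u i z * ?v) + (\<Sum>l<j. g j l z * ?v * u l z)) + g j j z * ?v * ?v"
        by (simp add: K_def sum.distrib)
      also have "(\<Sum>i<j. g i j z * u i z * ?v) + (\<Sum>l<j. g j l z * ?v * u l z) = ?v * T z"
        unfolding T_def sum_distrib_left sum.distrib[symmetric]
        by (rule sum.cong) (auto simp: algebra_simps)
      finally have Qz: "Q z = x z ^ N * E z + (H + ?y * ?v) + (K + ?v * T z + g j j z * ?v * ?v) + (S + ?v\<^sup>2)"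
        using elim(1) by (simp add: H_def S_def)
      have Vz: "(V z)\<^sup>2 = A z * ?v\<^sup>2 + (A z * ?b) * (?v * L z) + (A z * ?b) * (L z)\<^sup>2 * ?b / 4"
        unfolding V_def power_mult_distrib elim(2) by (simp add: power2_eq_square field_simps)
      have 1: "x z ^ N * E' z = x z ^ N * E z - ?y\<^sup>2 * ?b / 4"
      proof -
        have "x z ^ N * x z ^ (2 * s - N) = (x z ^ s)\<^sup>2"
          using N by (simp add: power_add[symmetric] power_mult[symmetric] mult.commute)
        then show ?thesis unfolding E'_def by (simp add: algebra_simps power2_eq_square)
      qed
      have 2: "(\<Sum>i<j. x z ^ s * h' i z * u i z) = H - ?y * (?b / 2) * T z"
        unfolding H_def T_def h'_def sum_distrib_left sum_subtractf[symmetric]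
        by (rule sum.cong) (auto simp: algebra_simps)
      have 3: "(\<Sum>i<j. \<Sum>l<j. g' i l z * u i z * u l z) = K - T z * T z * (?b / 4)"
      proof -
        have "T z * T z = (\<Sum>i<j. \<Sum>l<j. ((g i j z + g j i z) * u i z) * ((g l j z + g j l z) * u l z))"
          unfolding T_def by (rule sum_product)
        then show ?thesis
          unfolding K_def g'_def
          by (simp only: sum_distrib_right sum_subtractf[symmetric])
            (intro sum.cong refl, simp add: algebra_simps add_divide_distrib)
      qed
      show ?case
        unfolding 1 2 3 S_def[symmetric] Qz Vz AB
        by (simp add: A_def L_def power2_eq_square algebra_simps)
    qed
  qed (use u in auto)
  then obtain X U where XU: "sdiff_germ n X" "X origin = 0" "sdiff n X origin cx"
    "\<And>i. i < j \<Longrightarrow> sdiff_germ n (U i) \<and> U i origin = 0 \<and> sdiff n (U i) origin (c i)"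
    "\<forall>\<^sub>F z in cnhds n origin. Q z - (V z)\<^sup>2 = X z ^ N + (\<Sum>i<j. (U i z)\<^sup>2)"
    by blast
  have "\<forall>\<^sub>F z in cnhds n origin. Q z = X z ^ N + (\<Sum>i<Suc j. ((U(j := V)) i z)\<^sup>2)"
    using XU(5) by eventually_elim (simp add: algebra_simps)
  then show ?case
    using XU(1-4) V1 V2 V3
    by (intro exI[of _ X] exI[of _ "U(j := V)"]) (auto simp: less_Suc_eq)
qed

section \<open>Expansion of monomials in powers of \<open>x\<close> and the deviations
  \<open>u i\<close> from the curve\<close>

text \<open>
  \<open>N\<close> stands for the weighted degree and \<open>D\<close> for the largest weight of the \<open>u i\<close>; for \<open>N < D\<close> the
  truncated exponent \<open>N - D\<close> is \<open>0\<close>. Vanishing of the \<open>g i l\<close> at the origin is all that is kept of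
  the weights of the quadratic part.
\<close>

definition weighted_form ::
  "nat \<Rightarrow> ((nat \<Rightarrow> complex) \<Rightarrow> complex) \<Rightarrow> nat \<Rightarrow> (nat \<Rightarrow> (nat \<Rightarrow> complex) \<Rightarrow> complex) \<Rightarrow> nat \<Rightarrow> nat \<Rightarrow>
    ((nat \<Rightarrow> complex) \<Rightarrow> complex) \<Rightarrow> bool" where
  "weighted_form n x m u D N f \<longleftrightarrow> (\<exists>h g.
     (\<forall>i. sdiff_germ n (h i)) \<and> (\<forall>i l. sdiff_germ n (g i l)) \<and>
     (2 * D < N \<longrightarrow> (\<forall>i l. g i l origin = 0)) \<and>
     (\<forall>z. f z = x z ^ N + (\<Sum>i<m. x z ^ (N - D) * h i z * u i z) +
        (\<Sum>i<m. \<Sum>l<m. g i l z * u i z * u l z)))"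

lemma weighted_form_x: "weighted_form n x m u D 1 x"
  unfolding weighted_form_def
  by (rule exI[of _ "\<lambda>_ _. 0"], rule exI[of _ "\<lambda>_ _ _. 0"]) auto

lemma weighted_form_1: "weighted_form n x m u D 0 (\<lambda>_. 1)"
  unfolding weighted_form_def
  by (rule exI[of _ "\<lambda>_ _. 0"], rule exI[of _ "\<lambda>_ _ _. 0"]) auto

lemma weighted_form_add:
  assumes f: "weighted_form n x m u D N f" and N: "N \<le> D" and j: "j < m"
  shows "weighted_form n x m u D N (\<lambda>z. f z + u j z)"
proof -
  from f obtain h g where hg: "\<And>i. sdiff_germ n (h i)" "\<And>i l. sdiff_germ n (g i l)"
    "\<And>z. f z = x z ^ N + (\<Sum>i<m. x z ^ (N - D) * h i z * u i z) +
        (\<Sum>i<m. \<Sum>l<m. g i l z * u i z * u l z)"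
    unfolding weighted_form_def by blast
  let ?h = "\<lambda>i z. h i z + (if i = j then 1 else 0)"
  have "(\<Sum>i<m. x z ^ (N - D) * ?h i z * u i z) =
      (\<Sum>i<m. x z ^ (N - D) * h i z * u i z) + (\<Sum>i<m. if i = j then u j z else 0)" for z
    unfolding sum.distrib[symmetric] using N by (intro sum.cong) (auto simp: algebra_simps)
  then have "(\<Sum>i<m. x z ^ (N - D) * ?h i z * u i z) =
      (\<Sum>i<m. x z ^ (N - D) * h i z * u i z) + u j z" for z
    using j by simp
  then show ?thesis
    unfolding weighted_form_def
    by (intro exI[of _ ?h] exI[of _ g]) (use hg N in auto)
qed

text \<open>Truncated subtraction satisfies \<open>N + (N' - D) \<ge> N + N' - D\<close>, so both
  products of a power with a linear part are divisible by the required power of \<open>x\<close>. If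
  \<open>2 * D < N + N'\<close>, the three contributions to the quadratic part vanish at the origin:
  in the product of the linear parts \<open>(N - D) + (N' - D) > 0\<close>; in the others either the
  accompanying factor vanishes, or its weight is \<open>0\<close> and then the other form alone has
  weight above \<open>2 * D\<close>.\<close>

lemma weighted_form_mult:
  assumes x: "sdiff_germ n x" "x origin = 0"
    and u: "\<And>i. i < m \<Longrightarrow> sdiff_germ n (u i)" "\<And>i. i < m \<Longrightarrow> u i origin = 0"
    and f: "weighted_form n x m u D N f" and f': "weighted_form n x m u D N' f'"
  shows "weighted_form n x m u D (N + N') (\<lambda>z. f z * f' z)"
proof -
  from f obtain h g where hg: "\<And>i. sdiff_germ n (h i)" "\<And>i l. sdiff_germ n (g i l)"
    "2 * D < N \<Longrightarrow> (\<forall>i l. g i l origin = 0)"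
    and fz: "\<And>z. f z = x z ^ N + (\<Sum>i<m. x z ^ (N - D) * h i z * u i z) +
        (\<Sum>i<m. \<Sum>l<m. g i l z * u i z * u l z)"
    unfolding weighted_form_def by blast
  from f' obtain h' g' where hg': "\<And>i. sdiff_germ n (h' i)" "\<And>i l. sdiff_germ n (g' i l)"
    "2 * D < N' \<Longrightarrow> (\<forall>i l. g' i l origin = 0)"
    and f'z: "\<And>z. f' z = x z ^ N' + (\<Sum>i<m. x z ^ (N' - D) * h' i z * u i z) +
        (\<Sum>i<m. \<Sum>l<m. g' i l z * u i z * u l z)"
    unfolding weighted_form_def by blast
  define P where "P = N + N' - D"
  \<comment> \<open>\<open>r\<close> is \<open>f\<close> without its quadratic part
    \<open>K\<close>. The asymmetric splitting of \<open>f * f'\<close> into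
    \<open>r * (f' - K')\<close>, \<open>r * K'\<close> and \<open>K * f'\<close> keeps everything
    quadratic in \<open>u\<close>, with the higher terms hidden in the coefficients.\<close>
  define r where "r = (\<lambda>z. x z ^ N + (\<Sum>i<m. x z ^ (N - D) * h i z * u i z))"
  \<comment> \<open>The exponents over \<open>P\<close> are the surplus caused by truncation; they
    are \<open>0\<close> when \<open>N' \<ge> D\<close>, respectively
    \<open>N \<ge> D\<close>.\<close>
  define h'' where "h'' = (\<lambda>i z. x z ^ (N + (N' - D) - P) * h' i z + x z ^ (N' + (N - D) - P) * h i z)"
  define g'' where "g'' = (\<lambda>i l z. x z ^ (N - D) * x z ^ (N' - D) * h i z * h' l z +
     r z * g' i l z + f' z * g i l z)"
  have r: "sdiff_germ n r" unfolding r_def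
    by (intro sdiff_germ_add sdiff_germ_sum sdiff_germ_mult sdiff_germ_power x hg u) auto
  have f'_eq: "f' = (\<lambda>z. x z ^ N' + (\<Sum>i<m. x z ^ (N' - D) * h' i z * u i z) +
        (\<Sum>i<m. \<Sum>l<m. g' i l z * u i z * u l z))"
    using f'z by auto
  have f'g: "sdiff_germ n f'" unfolding f'_eq
    by (intro sdiff_germ_add sdiff_germ_sum sdiff_germ_mult sdiff_germ_power x hg' u) auto
  have r0: "r origin = 0 ^ N" unfolding r_def using x u by simp
  have f'0: "f' origin = 0 ^ N'" unfolding f'z using x u by simp
  have "g'' i l origin = 0" if "2 * D < N + N'" for i l
  proof -
    have "(N - D) + (N' - D) > 0" using that by arith
    then have "x origin ^ (N - D) * x origin ^ (N' - D) = 0"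
      unfolding power_add[symmetric] x(2) by simp
    moreover have "r origin * g' i l origin = 0"
      using that hg'(3) by (cases N) (auto simp: r0)
    moreover have "f' origin * g i l origin = 0"
      using that hg(3) by (cases N') (auto simp: f'0)
    ultimately show ?thesis unfolding g''_def by (simp only: mult_zero_left add_0_left)
  qed
  moreover have "sdiff_germ n (h'' i)" for i
    unfolding h''_def by (intro sdiff_germ_add sdiff_germ_mult sdiff_germ_power x hg hg')
  moreover have "sdiff_germ n (g'' i l)" for i l
    unfolding g''_def by (intro sdiff_germ_add sdiff_germ_mult sdiff_germ_power x hg hg' r f'g)
  moreover have "f z * f' z = x z ^ (N + N') + (\<Sum>i<m. x z ^ (N + N' - D) * h'' i z * u i z) +
        (\<Sum>i<m. \<Sum>l<m. g'' i l z * u i z * u l z)" for z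
  proof -
    define H where "H = (\<Sum>i<m. x z ^ (N - D) * h i z * u i z)"
    define K where "K = (\<Sum>i<m. \<Sum>l<m. g i l z * u i z * u l z)"
    define H' where "H' = (\<Sum>i<m. x z ^ (N' - D) * h' i z * u i z)"
    define K' where "K' = (\<Sum>i<m. \<Sum>l<m. g' i l z * u i z * u l z)"
    have p: "x z ^ P * x z ^ (N + (N' - D) - P) = x z ^ N * x z ^ (N' - D)"
      "x z ^ P * x z ^ (N' + (N - D) - P) = x z ^ N' * x z ^ (N - D)"
      unfolding power_add[symmetric] P_def by (rule arg_cong[of _ _ "\<lambda>k. x z ^ k"], arith)+
    have "(\<Sum>i<m. x z ^ P * h'' i z * u i z) = (\<Sum>i<m. x z ^ P * x z ^ (N + (N' - D) - P) * (h' i z * u i z)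
       + x z ^ P * x z ^ (N' + (N - D) - P) * (h i z * u i z))"
      unfolding h''_def by (intro sum.cong refl) (simp add: algebra_simps)
    also have "\<dots> = x z ^ N * H' + x z ^ N' * H"
      unfolding p H_def H'_def sum_distrib_left sum.distrib by (simp add: mult.assoc)
    finally have 1: "(\<Sum>i<m. x z ^ P * h'' i z * u i z) = x z ^ N * H' + x z ^ N' * H" .
    have 2: "(\<Sum>i<m. \<Sum>l<m. g'' i l z * u i z * u l z) = H * H' + r z * K' + f' z * K"
    proof -
      have "H * H' = (\<Sum>i<m. \<Sum>l<m. (x z ^ (N - D) * h i z * u i z) * (x z ^ (N' - D) * h' l z * u l z))"
        unfolding H_def H'_def by (rule sum_product)
      then show ?thesis
        unfolding K_def K'_def g''_def
        by (simp only: sum_distrib_left sum.distrib[symmetric])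
          (intro sum.cong refl, simp add: algebra_simps)
    qed
    have 3: "f z = r z + K" "r z = x z ^ N + H" "f' z = x z ^ N' + H' + K'"
      unfolding fz f'z r_def H_def K_def H'_def K'_def by simp_all
    show ?thesis
      unfolding P_def[symmetric] 1 2 power_add 3 by (simp add: algebra_simps)
  qed
  ultimately show ?thesis
    unfolding weighted_form_def by (intro exI[of _ h''] exI[of _ g'']) blast
qed

lemma weighted_form_power:
  assumes x: "sdiff_germ n x" "x origin = 0"
    and u: "\<And>i. i < m \<Longrightarrow> sdiff_germ n (u i)" "\<And>i. i < m \<Longrightarrow> u i origin = 0"
    and f: "weighted_form n x m u D N f"
  shows "weighted_form n x m u D (k * N) (\<lambda>z. f z ^ k)"
proof (induction k)
  case 0
  then show ?case using weighted_form_1 by simp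
next
  case (Suc k)
  show ?case using weighted_form_mult[OF x u f Suc] by simp
qed

lemma weighted_form_prod:
  fixes k :: nat
  assumes x: "sdiff_germ n x" "x origin = 0"
    and u: "\<And>i. i < m \<Longrightarrow> sdiff_germ n (u i)" "\<And>i. i < m \<Longrightarrow> u i origin = 0"
    and f: "\<And>i. i < k \<Longrightarrow> weighted_form n x m u D (N i) (f i)"
  shows "weighted_form n x m u D (\<Sum>i<k. N i) (\<lambda>z. \<Prod>i<k. f i z)"
  using f
proof (induction k)
  case 0
  then show ?case using weighted_form_1 by simp
next
  case (Suc k)
  show ?case using weighted_form_mult[OF x u Suc.IH Suc.prems[of k]] Suc.prems by simp
qed

text \<open>Since \<open>z (Suc i) = z i ^ d + u i z\<close>, induction gives the coordinate
  \<open>z i\<close> the weight \<open>d ^ i\<close>. The bare summand \<open>u i\<close> is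
  admissible because all these weights are at most \<open>d ^ m\<close>, so that its power of
  \<open>x\<close> has exponent \<open>0\<close>.\<close>

lemma weighted_form_monomial:
  assumes d: "d \<ge> 1" and u: "u = (\<lambda>i z. z (Suc i) - z i ^ d)"
    and m: "n = Suc m"
  shows "weighted_form n (\<lambda>z. z 0) m u (d ^ m) (\<Sum>i<n. a i * d ^ i) (\<lambda>z. \<Prod>i<n. z i ^ a i)"
proof -
  have x: "sdiff_germ n (\<lambda>z. z 0)" using m by (intro sdiff_germ_coord) simp
  have u1: "sdiff_germ n (u i)" if "i < m" for i
    unfolding u using that m by (intro sdiff_germ_diff sdiff_germ_power sdiff_germ_coord) auto
  have u2: "u i origin = 0" for i
    unfolding u using d by simp
  have coord: "weighted_form n (\<lambda>z. z 0) m u (d ^ m) (d ^ i) (\<lambda>z. z i)" if "i \<le> m" for i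
    using that
  proof (induction i)
    case 0
    show ?case using weighted_form_x by simp
  next
    case (Suc i)
    then have "weighted_form n (\<lambda>z. z 0) m u (d ^ m) (d * d ^ i) (\<lambda>z. z i ^ d)"
      by (intro weighted_form_power[OF x _ u1 u2]) auto
    then have "weighted_form n (\<lambda>z. z 0) m u (d ^ m) (d * d ^ i) (\<lambda>z. z i ^ d + u i z)"
    proof (rule weighted_form_add)
      have "d ^ Suc i \<le> d ^ m" using d Suc.prems by (intro power_increasing) auto
      then show "d * d ^ i \<le> d ^ m" by simp
    qed (use Suc.prems in auto)
    then show ?case by (simp add: u)
  qed
  show ?thesis
  proof (rule weighted_form_prod[OF x _ u1 u2])
    fix i assume "i < n"
    then show "weighted_form n (\<lambda>z. z 0) m u (d ^ m) (a i * d ^ i) (\<lambda>z. z i ^ a i)"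
      using m by (intro weighted_form_power[OF x _ u1 u2] coord) auto
  qed simp_all
qed

text \<open>The single inequality \<open>2 * d ^ m < N\<close> serves twice: it makes the quadratic
  coefficients vanish at the origin, and it gives \<open>N < 2 * s\<close> for
  \<open>s = N - d ^ m\<close>.\<close>

lemma diagonalize_witness:
  assumes d: "d \<ge> 2" and n: "n = Suc m" and N: "N = (\<Sum>i<n. a i * d ^ i)" "2 * d ^ m < N"
  shows "\<exists>X U. sdiff_germ n X \<and> X origin = 0 \<and> sdiff n X origin (\<lambda>j. if j = 0 then 1 else 0) \<and>
    (\<forall>i<m. sdiff_germ n (U i) \<and> U i origin = 0 \<and> sdiff n (U i) origin (\<lambda>j. if j = Suc i then 1 else 0)) \<and>
    (\<forall>\<^sub>F z in cnhds n origin. (\<Prod>i<n. z i ^ a i) + (\<Sum>i<m. (z (Suc i) - z i ^ d)\<^sup>2)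
       = X z ^ N + (\<Sum>i<m. (U i z)\<^sup>2))"
proof -
  define u :: "nat \<Rightarrow> (nat \<Rightarrow> complex) \<Rightarrow> complex" where "u = (\<lambda>i z. z (Suc i) - z i ^ d)"
  define D where "D = d ^ m"
  have D: "D \<ge> 1" using d by (simp add: D_def)
  have "weighted_form n (\<lambda>z. z 0) m u D N (\<lambda>z. \<Prod>i<n. z i ^ a i)"
    unfolding D_def N using weighted_form_monomial[of d u n m a] d n u_def by simp
  then obtain h g where hg: "\<And>i. sdiff_germ n (h i)" "\<And>i l. sdiff_germ n (g i l)"
      "\<And>i l. g i l origin = 0"
    and eq: "\<And>z. (\<Prod>i<n. z i ^ a i) = z 0 ^ N + (\<Sum>i<m. z 0 ^ (N - D) * h i z * u i z) +
        (\<Sum>i<m. \<Sum>l<m. g i l z * u i z * u l z)"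
    using N(2) unfolding weighted_form_def D_def by blast
  show ?thesis
  \<comment> \<open>From \<open>2 * D < N\<close> and \<open>D \<ge> 1\<close> follows
    \<open>N - D > D \<ge> 1\<close>, which is the condition \<open>s \<ge> 2\<close>.\<close>
  proof (rule diagonalize_quadratic[where x = "\<lambda>z. z 0" and u = u and s = "N - D"
        and E = "\<lambda>_. 1" and h = h and g = g])
    fix i assume i: "i < m"
    show "sdiff_germ n (u i)"
      unfolding u_def using i n by (intro sdiff_germ_diff sdiff_germ_power sdiff_germ_coord) auto
    \<comment> \<open>Here \<open>d \<ge> 2\<close> is essential: \<open>z i ^ d\<close> is then of
      second order, so \<open>u i\<close> has the differential of the coordinate
      \<open>z (Suc i)\<close>.\<close>
    have "sdiff n (\<lambda>z. z i * ((- 1) * z i ^ (d - 1))) origin (\<lambda>_. 0)"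
      using d i n
      by (intro sdiff_mult_zero sdiff_germ_mult sdiff_germ_power sdiff_germ_coord sdiff_germ_const) auto
    then have "sdiff n (\<lambda>z. z (Suc i) + z i * ((- 1) * z i ^ (d - 1))) origin
        (\<lambda>j. (if j = Suc i then 1 else 0) + 0)"
      using i n by (intro sdiff_add sdiff_coord) auto
    moreover have "z (Suc i) + z i * ((- 1) * z i ^ (d - 1)) = u i z" for z
      using d by (simp add: u_def power_eq_if)
    ultimately show "sdiff n (u i) origin (\<lambda>j. if j = Suc i then 1 else 0)"
      by (simp only: add_0_right)
  next
    show "\<forall>\<^sub>F z in cnhds n origin. (\<Prod>i<n. z i ^ a i) + (\<Sum>i<m. (z (Suc i) - z i ^ d)\<^sup>2) =
       z 0 ^ N * 1 + (\<Sum>i<m. z 0 ^ (N - D) * h i z * u i z) +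
       (\<Sum>i<m. \<Sum>l<m. g i l z * u i z * u l z) + (\<Sum>i<m. (u i z)\<^sup>2)"
      unfolding eq by (simp add: u_def)
  qed (use n d hg N(2) D in \<open>auto simp: D_def[symmetric] u_def intro: sdiff_coord sdiff_germ_coord\<close>)
qed

section \<open>Inverting perturbations of the identity\<close>

text \<open>Picard iteration from the origin. The steps are dominated by a geometric series, so each
  of the first \<open>n\<close> coordinates converges and the others stay \<open>0\<close>; the
  closed ball contains the limit, and the contraction estimate identifies it as a fixed
  point.\<close>

lemma banach_fixpoint_cspace:
  assumes \<rho>: "\<rho> \<ge> 0" and q: "0 \<le> q" "q < 1"
    and T: "\<And>z. z \<in> cspace n \<Longrightarrow> cnorm n z \<le> \<rho> \<Longrightarrow> T z \<in> cspace n \<and> cnorm n (T z) \<le> \<rho>"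
    and con: "\<And>z w. z \<in> cspace n \<Longrightarrow> cnorm n z \<le> \<rho> \<Longrightarrow> w \<in> cspace n \<Longrightarrow> cnorm n w \<le> \<rho> \<Longrightarrow>
      cdist n (T z) (T w) \<le> q * cdist n z w"
  shows "\<exists>z\<in>cspace n. cnorm n z \<le> \<rho> \<and> T z = z"
proof -
  define s where "s = (\<lambda>m. (T ^^ m) origin)"
  have s0: "s 0 = origin" and s_Suc: "s (Suc m) = T (s m)" for m by (simp_all add: s_def)
  have s: "s m \<in> cspace n \<and> cnorm n (s m) \<le> \<rho>" for m
  proof (induction m)
    case 0
    show ?case using \<rho> by (simp add: s0 cnorm_def L2_set_def)
  next
    case (Suc m)
    then show ?case using T by (simp add: s_Suc)
  qed
  define C where "C = cdist n (s 1) (s 0)"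
  have step: "cdist n (s (Suc m)) (s m) \<le> q ^ m * C" for m
  proof (induction m)
    case 0
    show ?case by (simp add: C_def)
  next
    case (Suc m)
    have "cdist n (s (Suc (Suc m))) (s (Suc m)) \<le> q * cdist n (s (Suc m)) (s m)"
      unfolding s_Suc[of "Suc m"] s_Suc[of m] using s[of "Suc m"] s[of m]
      unfolding s_Suc by (intro con) auto
    also have "\<dots> \<le> q * (q ^ m * C)"
      using Suc q(1) by (rule mult_left_mono)
    finally show ?case by simp
  qed
  have "\<exists>l. (\<lambda>m. s m i) \<longlonglongrightarrow> l" for i
  proof (cases "i < n")
    case True
    have "summable (\<lambda>m. s (Suc m) i - s m i)"
    proof (rule summable_comparison_test')
      show "summable (\<lambda>m. q ^ m * C)"
        using q by (intro summable_mult2 summable_geometric) simp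
      show "norm (s (Suc m) i - s m i) \<le> q ^ m * C" for m
        using cdist_component_le[OF True, of "s (Suc m)" "s m"] step[of m] by linarith
    qed
    from summable_LIMSEQ[OF this]
    show ?thesis unfolding sum_lessThan_telescope[of "\<lambda>m. s m i"] s0 by auto
  next
    case False
    then have "s m i = 0" for m using s[of m] by (simp add: cspace_def)
    then show ?thesis by auto
  qed
  then obtain z where z: "\<And>i. (\<lambda>m. s m i) \<longlonglongrightarrow> z i" by metis
  have zc: "z \<in> cspace n"
    unfolding cspace_def
  proof (intro CollectI allI impI)
    fix i assume "n \<le> i"
    then have "s m i = 0" for m using s[of m] by (simp add: cspace_def)
    with z[of i] show "z i = 0" by (simp add: LIMSEQ_const_iff)
  qed
  have "(\<lambda>m. sqrt (\<Sum>i<n. (cmod (s m i - z i))\<^sup>2)) \<longlonglongrightarrow> sqrt (\<Sum>i<n. (cmod (z i - z i))\<^sup>2)"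
    by (intro tendsto_intros z)
  then have d: "(\<lambda>m. cdist n (s m) z) \<longlonglongrightarrow> 0"
    by (simp add: cdist_def cnorm_def L2_set_def)
  have "cnorm n z \<le> \<rho> + cdist n (s m) z" for m
    using cdist_triangle[of n z origin "s m"] s[of m] cdist_commute[of n z "s m"] by simp
  moreover have "(\<lambda>m. \<rho> + cdist n (s m) z) \<longlonglongrightarrow> \<rho> + 0"
    by (intro tendsto_intros d)
  ultimately have z\<rho>: "cnorm n z \<le> \<rho>"
    using LIMSEQ_le_const[of "\<lambda>m. \<rho> + cdist n (s m) z" "\<rho> + 0" "cnorm n z"] by simp
  have "cdist n (T z) z \<le> q * cdist n (s m) z + cdist n (s (Suc m)) z" for m
  proof -
    have "cdist n (T z) (s (Suc m)) \<le> q * cdist n z (s m)"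
      unfolding s_Suc using zc z\<rho> s[of m] by (intro con) auto
    then show ?thesis
      using cdist_triangle[of n "T z" z "s (Suc m)"] cdist_commute[of n z "s m"] by simp
  qed
  moreover have "(\<lambda>m. q * cdist n (s m) z + cdist n (s (Suc m)) z) \<longlonglongrightarrow> q * 0 + 0"
    by (intro tendsto_intros d LIMSEQ_Suc[OF d])
  ultimately have "cdist n (T z) z \<le> 0"
    using LIMSEQ_le_const[of "\<lambda>m. q * cdist n (s m) z + cdist n (s (Suc m)) z" "q * 0 + 0" "cdist n (T z) z"]
    by simp
  then have "T z = z"
    using cdist_eq_0[of "T z" n z] T[OF zc z\<rho>] zc cdist_nonneg[of n "T z" z] by auto
  then show ?thesis using zc z\<rho> by blast
qed

lemma linform_sum_arg:
  "linform n c (\<lambda>i. \<Sum>j\<in>J. a j * b j i) = (\<Sum>j\<in>J. a j * linform n c (b j))"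
  unfolding linform_def sum_distrib_left
  by (subst sum.swap) (simp add: mult.left_commute)

text \<open>The rows \<open>c i\<close> form a matrix that differs from the identity by less than an
  invertible amount. Contraction gives surjectivity, and the columns \<open>b j\<close> of the
  inverse are preimages of the unit vectors. The same estimate forces the kernel to be trivial,
  which turns equality of images into the expansion of \<open>v\<close> itself.\<close>

lemma linear_inverse:
  assumes near: "\<And>v. v \<in> cspace n \<Longrightarrow>
    cnorm n (\<lambda>i. v i - (if i < n then linform n (c i) v else 0)) \<le> 3/4 * cnorm n v"
  obtains b where "\<forall>v\<in>cspace n. \<forall>i. v i = (\<Sum>j<n. linform n (c j) v * b j i)"
proof -
  define A where "A = (\<lambda>v i. if i < n then linform n (c i) v else 0)"
  have A: "A v \<in> cspace n" for v by (simp add: A_def cspace_def)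
  have near: "cnorm n (\<lambda>i. v i - A v i) \<le> 3/4 * cnorm n v" if "v \<in> cspace n" for v
    using near[OF that] by (simp add: A_def)
  have A_diff: "A (\<lambda>i. v i - w i) = (\<lambda>i. A v i - A w i)" for v w
    by (auto simp: A_def linform_diff)
  have surj: "\<exists>v\<in>cspace n. A v = y" if y: "y \<in> cspace n" for y
  proof -
    define T where "T = (\<lambda>v i. y i + (v i - A v i))"
    \<comment> \<open>The radius is the solution \<open>\<rho>\<close> of
      \<open>cnorm n y + 3/4 * \<rho> = \<rho>\<close>.\<close>
    have "\<exists>v\<in>cspace n. cnorm n v \<le> 4 * cnorm n y \<and> T v = v"
    proof (rule banach_fixpoint_cspace[where q = "3/4"])
      fix v assume v: "v \<in> cspace n" "cnorm n v \<le> 4 * cnorm n y"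
      have "cnorm n (T v) \<le> cnorm n y + cnorm n (\<lambda>i. v i - A v i)"
        unfolding T_def by (rule cnorm_triangle)
      moreover have "T v \<in> cspace n"
        unfolding T_def by (intro cspace_add cspace_diff y v A)
      ultimately show "T v \<in> cspace n \<and> cnorm n (T v) \<le> 4 * cnorm n y"
        using near[OF v(1)] v(2) by simp
    next
      fix v w assume "v \<in> cspace n" "w \<in> cspace n"
      then have "cnorm n (\<lambda>i. (v i - w i) - A (\<lambda>i. v i - w i) i) \<le> 3/4 * cdist n v w"
        unfolding cdist_def by (intro near cspace_diff)
      moreover have "(\<lambda>i. T v i - T w i) = (\<lambda>i. (v i - w i) - A (\<lambda>i. v i - w i) i)"
        unfolding T_def A_diff by auto
      ultimately show "cdist n (T v) (T w) \<le> 3/4 * cdist n v w"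
        unfolding cdist_def[of n "T v"] by (simp only:)
    qed auto
    then obtain v where v: "v \<in> cspace n" "T v = v" by blast
    have "A v = y"
    proof
      fix i
      have "T v i = v i" using v(2) by simp
      then show "A v i = y i" by (simp add: T_def)
    qed
    then show ?thesis using v by blast
  qed
  define e :: "nat \<Rightarrow> nat \<Rightarrow> complex" where "e = (\<lambda>j i. if i = j \<and> j < n then 1 else 0)"
  have "\<forall>j. \<exists>v\<in>cspace n. A v = e j"
    using surj by (auto simp: e_def cspace_def)
  then obtain b where b: "\<And>j. b j \<in> cspace n" "\<And>j. A (b j) = e j" by metis
  show thesis
  proof (intro that[of b] ballI allI)
    fix v i assume v: "v \<in> cspace n"
    define v' where "v' = (\<lambda>i. \<Sum>j<n. linform n (c j) v * b j i)"
    have v'c: "v' \<in> cspace n" using b(1) by (simp add: cspace_def v'_def)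
    have lb: "linform n (c l) (b j) = (if l = j then 1 else 0)" if "l < n" "j < n" for l j
      using fun_cong[OF b(2)[of j], of l] that by (simp add: A_def e_def)
    have "A v' = A v"
    proof
      fix l
      have "linform n (c l) v' = (\<Sum>j<n. if j = l then linform n (c j) v else 0)" if "l < n"
        unfolding v'_def linform_sum_arg using lb[OF that] by (intro sum.cong) auto
      then show "A v' l = A v l" by (simp add: A_def)
    qed
    then have "A (\<lambda>i. v i - v' i) = origin" by (simp add: A_diff)
    then have "cnorm n (\<lambda>i. v i - v' i) \<le> 3/4 * cnorm n (\<lambda>i. v i - v' i)"
      using near[OF cspace_diff[OF v v'c]] by simp
    then have "cdist n v v' = 0" unfolding cdist_def using cnorm_nonneg[of n "\<lambda>i. v i - v' i"] by linarith
    then show "v i = (\<Sum>j<n. linform n (c j) v * b j i)"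
      using cdist_eq_0[OF v v'c] v'_def by metis
  qed
qed

lemma complex_differentiable_family:
  assumes z: "z \<in> cspace n" and "\<And>i. i < n \<Longrightarrow> complex_differentiable n (\<lambda>w. \<Phi> w i) z"
  obtains c where "\<forall>e>0. \<forall>\<^sub>F w in cnhds n z.
     \<forall>i<n. cmod (\<Phi> w i - \<Phi> z i - linform n (c i) (\<lambda>i. w i - z i)) \<le> e * cdist n w z"
proof -
  define P where "P = (\<lambda>i c. \<forall>e>0. \<forall>\<^sub>F w in cnhds n z.
     cmod (\<Phi> w i - \<Phi> z i - linform n c (\<lambda>i. w i - z i)) \<le> e * cdist n w z)"
  define c where "c = (\<lambda>i. SOME c. P i c)"
  have ex: "\<exists>c. P i c" if "i < n" for i
    using assms(2)[OF that] unfolding P_def complex_differentiable_iff[OF z] .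
  have "P i (c i)" if "i < n" for i
    unfolding c_def by (rule someI_ex[OF ex[OF that]])
  then have "\<forall>\<^sub>F w in cnhds n z.
     cmod (\<Phi> w i - \<Phi> z i - linform n (c i) (\<lambda>i. w i - z i)) \<le> e * cdist n w z"
    if "i < n" "e > 0" for i e
    using that unfolding P_def by simp
  then have "\<forall>\<^sub>F w in cnhds n z. \<forall>i\<in>{..<n}.
      cmod (\<Phi> w i - \<Phi> z i - linform n (c i) (\<lambda>i. w i - z i)) \<le> e * cdist n w z" if "e > 0" for e
    using that by (intro eventually_ball_finite) simp_all
  then show thesis by (intro that[of c] allI impI) (simp only: Ball_def lessThan_iff)
qed

text \<open>The nonlinear estimate with constant \<open>1/2\<close> passes to the differential:
  testing it on small multiples of \<open>v\<close>, with linearization error at most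
  \<open>1/4\<close>, yields the constant \<open>3/4\<close>, so the differential is invertible. Its
  inverse is the differential of \<open>g\<close>, since the Lipschitz bound on \<open>g\<close>
  turns errors in \<open>w - z\<close> into errors in \<open>y' - y\<close>.\<close>

lemma complex_differentiable_inverse:
  assumes y: "y \<in> cspace n" and z: "z \<in> cspace n" "\<Phi> z = y" "g y = z"
    and g: "\<forall>\<^sub>F y' in cnhds n y. g y' \<in> cspace n \<and> \<Phi> (g y') = y' \<and> cdist n (g y') z \<le> 2 * cdist n y' y"
    and \<Phi>: "\<forall>\<^sub>F w in cnhds n z. cnorm n (\<lambda>i. (w i - z i) - (\<Phi> w i - \<Phi> z i)) \<le> 1/2 * cdist n w z"
    and d: "\<And>i. i < n \<Longrightarrow> complex_differentiable n (\<lambda>w. \<Phi> w i) z"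
    and i: "i < n"
  shows "complex_differentiable n (\<lambda>y. g y i) y"
proof -
  obtain c where c: "\<forall>e>0. \<forall>\<^sub>F w in cnhds n z.
     \<forall>i<n. cmod (\<Phi> w i - \<Phi> z i - linform n (c i) (\<lambda>i. w i - z i)) \<le> e * cdist n w z"
    by (rule complex_differentiable_family[OF z(1), where \<Phi> = \<Phi>]) (erule d, rule that)
  have near: "cnorm n (\<lambda>i. v i - (if i < n then linform n (c i) v else 0)) \<le> 3/4 * cnorm n v"
    if v: "v \<in> cspace n" for v
  proof -
    \<comment> \<open>Passing from coordinatewise bounds to \<open>cnorm\<close> costs a factor
      \<open>n\<close>, which leaves \<open>1/4\<close>.\<close>
    have e: "1 / (4 * real n) > 0" using i by simp
    obtain s where s: "s > 0" "\<forall>w\<in>cspace n. cdist n w z < s \<longrightarrow>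
        cnorm n (\<lambda>i. (w i - z i) - (\<Phi> w i - \<Phi> z i)) \<le> 1/2 * cdist n w z \<and>
        (\<forall>i<n. cmod (\<Phi> w i - \<Phi> z i - linform n (c i) (\<lambda>i. w i - z i)) \<le> 1 / (4 * real n) * cdist n w z)"
      using eventually_conj[OF \<Phi> c[rule_format, OF e]] unfolding eventually_cnhds[OF z(1)]
      by (elim exE conjE) (rule that)
    \<comment> \<open>Scales \<open>v\<close> into the ball of radius \<open>s\<close>; the added
      \<open>1\<close> avoids dividing by zero for \<open>v = 0\<close>.\<close>
    define t where "t = s / (cnorm n v + 1)"
    have p: "cnorm n v + 1 > 0" using cnorm_nonneg[of n v] by linarith
    then have t: "t > 0" using s by (simp add: t_def)
    define w where "w = (\<lambda>i. z i + complex_of_real t * v i)"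
    have w: "w \<in> cspace n" unfolding w_def by (intro cspace_add cspace_scale z v)
    have wz: "w i - z i = complex_of_real t * v i" for i by (simp add: w_def)
    have dw: "cdist n w z = t * cnorm n v"
      unfolding cdist_def wz cnorm_scale using t by simp
    also have "\<dots> < s" using s p by (simp add: t_def divide_simps)
    finally have "cdist n w z < s" .
    note est = mp[OF bspec[OF s(2) w] this]
    let ?A = "\<lambda>i. if i < n then linform n (c i) v else 0"
    have "cnorm n (\<lambda>i. \<Phi> w i - \<Phi> z i - complex_of_real t * ?A i) \<le> real n * (1 / (4 * real n) * cdist n w z)"
      using est by (intro cnorm_le_bound) (auto simp: wz linform_scale)
    also have "\<dots> = 1/4 * (t * cnorm n v)" using i by (simp add: dw)
    finally have 1: "cnorm n (\<lambda>i. \<Phi> w i - \<Phi> z i - complex_of_real t * ?A i) \<le> 1/4 * (t * cnorm n v)" .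
    have "t * cnorm n (\<lambda>i. v i - ?A i) = cnorm n (\<lambda>i. complex_of_real t * (v i - ?A i))"
      unfolding cnorm_scale using t by simp
    also have "(\<lambda>i. complex_of_real t * (v i - ?A i)) =
        (\<lambda>i. ((w i - z i) - (\<Phi> w i - \<Phi> z i)) + (\<Phi> w i - \<Phi> z i - complex_of_real t * ?A i))"
      unfolding wz right_diff_distrib by (rule ext) simp
    also have "cnorm n \<dots> \<le> 1/2 * (t * cnorm n v) + 1/4 * (t * cnorm n v)"
      using cnorm_triangle[of n "\<lambda>i. (w i - z i) - (\<Phi> w i - \<Phi> z i)"
        "\<lambda>i. \<Phi> w i - \<Phi> z i - complex_of_real t * ?A i"] est 1 unfolding dw by linarith
    finally have "t * cnorm n (\<lambda>i. v i - ?A i) \<le> t * (3/4 * cnorm n v)" by simp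
    then show ?thesis using t by (simp only: mult_le_cancel_left_pos)
  qed
  obtain b where b: "\<forall>v\<in>cspace n. \<forall>i. v i = (\<Sum>j<n. linform n (c j) v * b j i)"
    by (rule linear_inverse[OF near]) (assumption, rule that)
  show ?thesis
    unfolding complex_differentiable_iff[OF y]
  proof (intro exI[of _ "\<lambda>j. b j i"] allI impI)
    fix e :: real assume e: "e > 0"
    define B where "B = (\<Sum>j<n. cmod (b j i)) + 1"
    have B: "B > 0" unfolding B_def by (smt (verit) norm_ge_zero sum_nonneg)
    \<comment> \<open>\<open>B\<close> absorbs the coefficients of the inverse matrix, and the
      \<open>2\<close> cancels the Lipschitz constant of \<open>g\<close>.\<close>
    have e': "e / (2 * B) > 0" using e B by simp
    obtain s where s: "s > 0" "\<forall>w\<in>cspace n. cdist n w z < s \<longrightarrow>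
        (\<forall>i<n. cmod (\<Phi> w i - \<Phi> z i - linform n (c i) (\<lambda>i. w i - z i)) \<le> e / (2 * B) * cdist n w z)"
      using c[rule_format, OF e'] unfolding eventually_cnhds[OF z(1)]
      by (elim exE conjE) (rule that)
    have "\<forall>\<^sub>F y' in cnhds n y. cdist n y' y < s / 2"
      unfolding eventually_cnhds[OF y] using s(1) by (intro exI[of _ "s/2"]) simp
    with g eventually_in_cspace[of n y]
    show "\<forall>\<^sub>F y' in cnhds n y. cmod (g y' i - g y i - linform n (\<lambda>j. b j i) (\<lambda>i. y' i - y i))
        \<le> e * cdist n y' y"
    proof eventually_elim
      case (elim y')
      define w where "w = g y'"
      have w: "w \<in> cspace n" "\<Phi> w = y'" "cdist n w z \<le> 2 * cdist n y' y"
        using elim by (auto simp: w_def)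
      have "cdist n w z < s" using w(3) elim by linarith
      note est = mp[OF bspec[OF s(2) w(1)] this]
      have "g y' i - g y i = (\<Sum>j<n. linform n (c j) (\<lambda>i. w i - z i) * b j i)"
        using b[rule_format, OF cspace_diff[OF w(1) z(1)], of i] z by (simp add: w_def)
      then have "g y' i - g y i - linform n (\<lambda>j. b j i) (\<lambda>i. y' i - y i) =
         (\<Sum>j<n. b j i * (linform n (c j) (\<lambda>i. w i - z i) - (y' j - y j)))"
        unfolding linform_def[of n "\<lambda>j. b j i"]
        by (simp only: sum_subtractf[symmetric] right_diff_distrib mult.commute)
      also have "cmod \<dots> \<le> (\<Sum>j<n. cmod (b j i) * (e / (2 * B) * cdist n w z))"
      proof (rule sum_norm_le)
        fix j assume "j \<in> {..<n}"
        then have "cmod (y' j - y j - linform n (c j) (\<lambda>i. w i - z i)) \<le> e / (2 * B) * cdist n w z"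
          using est w(2) z(2) by auto
        then show "cmod (b j i * (linform n (c j) (\<lambda>i. w i - z i) - (y' j - y j)))
            \<le> cmod (b j i) * (e / (2 * B) * cdist n w z)"
          unfolding norm_mult by (intro mult_left_mono) (simp_all only: norm_minus_commute norm_ge_zero)
      qed
      also have "\<dots> \<le> B * (e / (2 * B) * cdist n w z)"
        unfolding sum_distrib_right[symmetric]
        by (rule mult_right_mono[OF _ mult_nonneg_nonneg[OF less_imp_le[OF e'] cdist_nonneg]])
          (simp add: B_def)
      also have "\<dots> = e / 2 * cdist n w z" using B by simp
      also have "\<dots> \<le> e / 2 * (2 * cdist n y' y)"
        using e w(3) by (intro mult_left_mono) auto
      finally show ?case by simp
    qed
  qed
qed

section \<open>Local biholomorphisms\<close>

lemma complex_differentiable_cong: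
  assumes z: "z \<in> cspace n" and f: "complex_differentiable n f z"
    and eq: "\<forall>\<^sub>F w in cnhds n z. f w = g w"
  shows "complex_differentiable n g z"
proof -
  obtain c where c: "\<forall>e>0. \<forall>\<^sub>F w in cnhds n z.
       cmod (f w - f z - linform n c (\<lambda>i. w i - z i)) \<le> e * cdist n w z"
    using f unfolding complex_differentiable_iff[OF z] by (elim exE) (rule that)
  have "f z = g z" by (rule eventually_cnhds_self[OF z eq])
  have "\<forall>\<^sub>F w in cnhds n z. cmod (g w - g z - linform n c (\<lambda>i. w i - z i)) \<le> e * cdist n w z"
    if "e > 0" for e
    using c[rule_format, OF that] eq by eventually_elim (simp add: \<open>f z = g z\<close>)
  then show ?thesis
    unfolding complex_differentiable_iff[OF z] by (intro exI[of _ c] allI impI)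
qed

text \<open>As the differential at the origin is the identity, strict differentiability makes
  \<open>\<Phi>\<close> minus the identity a contraction with constant \<open>1/2\<close> near the
  origin. This gives injectivity and two-sided Lipschitz bounds, and \<open>\<Phi> z = y\<close> is
  solved as a fixed point of \<open>z \<mapsto> y + (z - \<Phi> z)\<close>.\<close>

lemma inverse_function_cspace:
  assumes n: "n > 0"
    and \<Phi>0: "\<Phi> origin = origin" and \<Phi>_cspace: "\<And>z. \<Phi> z \<in> cspace n"
    and germ: "\<And>i. i < n \<Longrightarrow> sdiff_germ n (\<lambda>z. \<Phi> z i)"
    and deriv: "\<And>i. i < n \<Longrightarrow> sdiff n (\<lambda>z. \<Phi> z i) origin (\<lambda>j. if j = i then 1 else 0)"
  shows "local_biholomorphism n \<Phi>"
proof -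
  \<comment> \<open>The factor \<open>n\<close> lost in passing from coordinates to
    \<open>cnorm\<close> turns this into \<open>1/2\<close>.\<close>
  have e: "1 / (2 * real n) > 0" using n by simp
  have "\<forall>\<^sub>F p in cnhds n origin \<times>\<^sub>F cnhds n origin. \<forall>i\<in>{..<n}.
      cmod (\<Phi> (fst p) i - \<Phi> (snd p) i - (fst p i - snd p i)) \<le> 1 / (2 * real n) * cdist n (fst p) (snd p)"
  proof (intro eventually_ball_finite ballI)
    fix i assume i: "i \<in> {..<n}"
    then have i': "i < n" by simp
    show "\<forall>\<^sub>F p in cnhds n origin \<times>\<^sub>F cnhds n origin.
      cmod (\<Phi> (fst p) i - \<Phi> (snd p) i - (fst p i - snd p i)) \<le> 1 / (2 * real n) * cdist n (fst p) (snd p)"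
      using sdiffD[OF deriv[OF i'] e] unfolding linform_delta[OF i'] .
  qed simp
  then obtain P where P: "eventually P (cnhds n origin)" "\<forall>w v. P w \<longrightarrow> P v \<longrightarrow> (\<forall>i\<in>{..<n}.
      cmod (\<Phi> w i - \<Phi> v i - (w i - v i)) \<le> 1 / (2 * real n) * cdist n w v)"
    unfolding eventually_prod_same fst_conv snd_conv by (elim exE conjE) (rule that)
  \<comment> \<open>Differentiability at all points near the origin; it makes \<open>\<Phi>\<close>,
    and through it the inverse, holomorphic on whole neighbourhoods.\<close>
  have sd: "\<forall>\<^sub>F z in cnhds n origin. \<forall>i\<in>{..<n}. \<exists>c. sdiff n (\<lambda>z. \<Phi> z i) z c"
    using germ unfolding sdiff_germ_def by (intro eventually_ball_finite) simp_all
  obtain r where r: "r > 0" "\<forall>w\<in>cspace n. cdist n w origin < r \<longrightarrow>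
      P w \<and> (\<forall>i\<in>{..<n}. \<exists>c. sdiff n (\<lambda>z. \<Phi> z i) w c)"
    using eventually_conj[OF P(1) sd] unfolding eventually_cnhds[OF origin_in_cspace]
    by (elim exE conjE) (rule that)
  define R where "R = {z \<in> cspace n. cnorm n z < r}"
  have rP: "P w" "\<And>i. i < n \<Longrightarrow> \<exists>c. sdiff n (\<lambda>z. \<Phi> z i) w c" if "w \<in> R" for w
    using bspec[OF r(2), of w] that by (simp_all add: R_def)
  have con: "cnorm n (\<lambda>i. (w i - v i) - (\<Phi> w i - \<Phi> v i)) \<le> 1/2 * cdist n w v"
    if "w \<in> R" "v \<in> R" for w v
  proof -
    have "cmod ((w i - v i) - (\<Phi> w i - \<Phi> v i)) \<le> 1 / (2 * real n) * cdist n w v" if "i < n" for i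
      using P(2) rP(1)[OF \<open>w \<in> R\<close>] rP(1)[OF \<open>v \<in> R\<close>] that
      by (simp add: norm_minus_commute)
    then have "cnorm n (\<lambda>i. (w i - v i) - (\<Phi> w i - \<Phi> v i)) \<le> real n * (1 / (2 * real n) * cdist n w v)"
      by (rule cnorm_le_bound)
    then show ?thesis using n by simp
  qed
  have lower: "cdist n w v \<le> 2 * cdist n (\<Phi> w) (\<Phi> v)" and upper: "cdist n (\<Phi> w) (\<Phi> v) \<le> 2 * cdist n w v"
    if "w \<in> R" "v \<in> R" for w v
  proof -
    have "cdist n w v \<le> cnorm n (\<lambda>i. (w i - v i) - (\<Phi> w i - \<Phi> v i)) + cdist n (\<Phi> w) (\<Phi> v)"
      using cnorm_triangle[of n "\<lambda>i. (w i - v i) - (\<Phi> w i - \<Phi> v i)" "\<lambda>i. \<Phi> w i - \<Phi> v i"]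
      by (simp add: cdist_def)
    then show "cdist n w v \<le> 2 * cdist n (\<Phi> w) (\<Phi> v)"
      using con[OF that] by linarith
    have "cdist n (\<Phi> w) (\<Phi> v) \<le> cnorm n (\<lambda>i. (\<Phi> w i - \<Phi> v i) - (w i - v i)) + cdist n w v"
      using cnorm_triangle[of n "\<lambda>i. (\<Phi> w i - \<Phi> v i) - (w i - v i)" "\<lambda>i. w i - v i"]
      by (simp add: cdist_def)
    moreover have "cnorm n (\<lambda>i. (\<Phi> w i - \<Phi> v i) - (w i - v i)) = cnorm n (\<lambda>i. (w i - v i) - (\<Phi> w i - \<Phi> v i))"
      unfolding cnorm_def by (simp only: norm_minus_commute)
    ultimately show "cdist n (\<Phi> w) (\<Phi> v) \<le> 2 * cdist n w v"
      using con[OF that] cdist_nonneg[of n w v] by linarith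
  qed
  \<comment> \<open>For \<open>y\<close> of norm below \<open>r / 2\<close> the solution has norm at
    most \<open>2 * cnorm n y < r\<close>, so it stays in \<open>R\<close>. \<open>U\<close> is the
    part of \<open>R\<close> that is mapped into \<open>V\<close>, which makes the restriction
    bijective.\<close>
  define U where "U = {z \<in> R. cnorm n (\<Phi> z) < r / 2}"
  define V where "V = {y \<in> cspace n. cdist n y origin < r / 2}"
  have cn0: "cnorm n origin = 0" by (simp add: cnorm_def L2_set_def)
  have UR: "U \<subseteq> R" and Rc: "R \<subseteq> cspace n" by (auto simp: U_def R_def)
  have R_open: "openin (top_of_set (cspace n)) R"
    using openin_cball_cspace[of n origin r] by (simp add: R_def)
  have U_open: "openin (top_of_set (cspace n)) U"
    unfolding openin_cspace_iff
  proof (intro conjI ballI)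
    show "U \<subseteq> cspace n" using UR Rc by blast
    fix z assume z: "z \<in> U"
    then have zR: "z \<in> R" and zc: "z \<in> cspace n" using UR Rc by auto
    define s where "s = (r / 2 - cnorm n (\<Phi> z)) / 2"
    have s: "s > 0" using z by (simp add: s_def U_def)
    have "\<forall>\<^sub>F w in cnhds n z. cdist n w z < s"
      unfolding eventually_cnhds[OF zc] using s by blast
    moreover have "\<forall>\<^sub>F w in cnhds n z. w \<in> R"
      using R_open zR unfolding openin_cspace_iff by blast
    ultimately show "\<forall>\<^sub>F w in cnhds n z. w \<in> U"
    proof eventually_elim
      case (elim w)
      have "cnorm n (\<Phi> w) \<le> cdist n (\<Phi> w) (\<Phi> z) + cnorm n (\<Phi> z)"
        using cdist_triangle[of n "\<Phi> w" origin "\<Phi> z"] by simp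
      also have "\<dots> < r / 2"
        using upper[OF elim(2) zR] elim(1) by (simp add: s_def)
      finally show ?case using elim by (simp add: U_def)
    qed
  qed
  have V_open: "openin (top_of_set (cspace n)) V"
    unfolding V_def by (rule openin_cball_cspace)
  have inj: "inj_on \<Phi> R"
  proof (rule inj_onI)
    fix w v assume wv: "w \<in> R" "v \<in> R" "\<Phi> w = \<Phi> v"
    then have "cdist n w v \<le> 0" using lower[OF wv(1,2)] by simp
    then show "w = v"
      using cdist_eq_0[of w n v] wv Rc cdist_nonneg[of n w v] by auto
  qed
  have surj: "\<exists>z\<in>U. \<Phi> z = y" if y: "y \<in> V" for y
  proof -
    have yc: "y \<in> cspace n" "2 * cnorm n y < r" using y by (simp_all add: V_def)
    define T where "T = (\<lambda>z i. y i + (z i - \<Phi> z i))"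
    have "\<exists>z\<in>cspace n. cnorm n z \<le> 2 * cnorm n y \<and> T z = z"
    proof (rule banach_fixpoint_cspace[where q = "1/2"])
      fix z assume z: "z \<in> cspace n" "cnorm n z \<le> 2 * cnorm n y"
      then have zR: "z \<in> R" "origin \<in> R" using yc r(1) by (auto simp: R_def cn0)
      have "cnorm n (T z) \<le> cnorm n y + cnorm n (\<lambda>i. z i - \<Phi> z i)"
        unfolding T_def by (rule cnorm_triangle)
      moreover have "cnorm n (\<lambda>i. z i - \<Phi> z i) \<le> 1/2 * cnorm n z"
        using con[OF zR] by (simp add: \<Phi>0)
      moreover have "T z \<in> cspace n"
        unfolding T_def by (intro cspace_add cspace_diff yc z \<Phi>_cspace)
      ultimately show "T z \<in> cspace n \<and> cnorm n (T z) \<le> 2 * cnorm n y"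
        using z(2) by simp
    next
      fix z w assume z: "z \<in> cspace n" "cnorm n z \<le> 2 * cnorm n y"
        and w: "w \<in> cspace n" "cnorm n w \<le> 2 * cnorm n y"
      have zR: "z \<in> R" "w \<in> R" using yc z w by (auto simp: R_def)
      have "(\<lambda>i. T z i - T w i) = (\<lambda>i. (z i - w i) - (\<Phi> z i - \<Phi> w i))"
        unfolding T_def by auto
      then show "cdist n (T z) (T w) \<le> 1/2 * cdist n z w"
        using con[OF zR] unfolding cdist_def[of n "T z"] by (simp only:)
    qed auto
    then obtain z where z: "z \<in> cspace n" "cnorm n z \<le> 2 * cnorm n y" "T z = z" by blast
    have "\<Phi> z = y"
    proof
      fix i
      have "T z i = z i" using z(3) by simp
      then show "\<Phi> z i = y i" by (simp add: T_def)
    qed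
    moreover have "z \<in> U"
      using z yc \<open>\<Phi> z = y\<close> by (simp add: U_def R_def)
    ultimately show ?thesis by blast
  qed
  have \<Phi>V: "\<Phi> z \<in> V" if "z \<in> U" for z
    using that \<Phi>_cspace by (simp add: U_def V_def)
  have bij: "bij_betw \<Phi> U V"
    unfolding bij_betw_def using inj_on_subset[OF inj UR] \<Phi>V surj by blast
  define g where "g = inv_into U \<Phi>"
  have g: "g y \<in> U" "\<Phi> (g y) = y" if "y \<in> V" for y
    using that bij unfolding g_def bij_betw_def
    by (auto intro: inv_into_into f_inv_into_f)
  have \<Phi>_cd: "complex_differentiable n (\<lambda>w. \<Phi> w i) z" if "z \<in> R" "i < n" for z i
    using rP(2)[OF that] sdiff_imp_complex_differentiable that(1) Rc by blast
  have g_cd: "complex_differentiable n (\<lambda>y. g y i) y" if y: "y \<in> V" and i: "i < n" for y i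
  proof (rule complex_differentiable_inverse[where z = "g y" and \<Phi> = \<Phi>])
    have gR: "g y \<in> R" using g[OF y] UR by blast
    then show gc: "g y \<in> cspace n" using Rc by blast
    show "y \<in> cspace n" using y by (simp add: V_def)
    have "\<forall>\<^sub>F y' in cnhds n y. y' \<in> V"
      using V_open y unfolding openin_cspace_iff by blast
    then show "\<forall>\<^sub>F y' in cnhds n y. g y' \<in> cspace n \<and> \<Phi> (g y') = y' \<and>
        cdist n (g y') (g y) \<le> 2 * cdist n y' y"
    proof eventually_elim
      case (elim y')
      have "g y' \<in> R" using g[OF elim] UR by blast
      then show ?case
        using lower[OF _ gR, of "g y'"] g[OF elim] g[OF y] Rc by auto
    qed
    have "\<forall>\<^sub>F w in cnhds n (g y). w \<in> R"
      using R_open gR unfolding openin_cspace_iff by blast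
    then show "\<forall>\<^sub>F w in cnhds n (g y). cnorm n (\<lambda>i. w i - g y i - (\<Phi> w i - \<Phi> (g y) i))
        \<le> 1/2 * cdist n w (g y)"
      by (rule eventually_mono) (rule con[OF _ gR])
    show "complex_differentiable n (\<lambda>w. \<Phi> w i) (g y)" if "i < n" for i
      by (rule \<Phi>_cd[OF gR that])
  qed (use g[OF y] i in auto)
  show ?thesis
    unfolding local_biholomorphism_def
  proof (rule conjI, rule \<Phi>0, rule exI[of _ U], rule exI[of _ V], intro conjI)
    show "open_nbhd0 n U" "open_nbhd0 n V"
      using U_open V_open r(1) \<Phi>0 by (simp_all add: open_nbhd0_def U_def V_def R_def cn0)
    show "holomorphic_map_Cn n \<Phi> U"
      unfolding holomorphic_map_Cn_def holomorphic_Cn_def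
      using U_open \<Phi>_cspace \<Phi>_cd UR by blast
    show "holomorphic_map_Cn n (inv_into U \<Phi>) V"
      unfolding holomorphic_map_Cn_def holomorphic_Cn_def g_def[symmetric]
      using V_open g_cd g UR Rc by blast
  qed (rule bij)
qed

section \<open>Chain rule and composition of local biholomorphisms\<close>

lemma complex_differentiable_map_lipschitz:
  assumes z: "z \<in> cspace n" and d: "\<forall>i<n. complex_differentiable n (\<lambda>w. \<Phi> w i) z"
  obtains K where "K > 0" "\<forall>\<^sub>F w in cnhds n z. cdist n (\<Phi> w) (\<Phi> z) \<le> K * cdist n w z"
proof -
  obtain c where c: "\<forall>e>0. \<forall>\<^sub>F w in cnhds n z.
     \<forall>i<n. cmod (\<Phi> w i - \<Phi> z i - linform n (c i) (\<lambda>i. w i - z i)) \<le> e * cdist n w z"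
    by (rule complex_differentiable_family[OF z, where \<Phi> = \<Phi>]) (use d in simp, rule that)
  define K where "K = (\<Sum>i<n. 1 + (\<Sum>j<n. cmod (c i j)))"
  have K: "K \<ge> 0" unfolding K_def by (intro sum_nonneg add_nonneg_nonneg) auto
  show thesis
  proof (rule that[of "K + 1"])
    show "K + 1 > 0" using K by linarith
    show "\<forall>\<^sub>F w in cnhds n z. cdist n (\<Phi> w) (\<Phi> z) \<le> (K + 1) * cdist n w z"
      using c[rule_format, OF zero_less_one]
    proof eventually_elim
      case (elim w)
      have "cdist n (\<Phi> w) (\<Phi> z) \<le> (\<Sum>i<n. cmod (\<Phi> w i - \<Phi> z i))"
        unfolding cdist_def by (rule cnorm_le_sum)
      also have "\<dots> \<le> (\<Sum>i<n. (1 + (\<Sum>j<n. cmod (c i j))) * cdist n w z)"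
      proof (rule sum_mono)
        fix i assume "i \<in> {..<n}"
        then have "cmod (\<Phi> w i - \<Phi> z i - linform n (c i) (\<lambda>i. w i - z i)) \<le> 1 * cdist n w z"
          using elim by simp
        then show "cmod (\<Phi> w i - \<Phi> z i) \<le> (1 + (\<Sum>j<n. cmod (c i j))) * cdist n w z"
          using norm_triangle_sub[of "\<Phi> w i - \<Phi> z i" "linform n (c i) (\<lambda>i. w i - z i)"]
            cmod_linform_diff_le[of n "c i" w z]
          unfolding distrib_right by linarith
      qed
      also have "\<dots> = K * cdist n w z" by (simp add: K_def sum_distrib_right)
      also have "\<dots> \<le> (K + 1) * cdist n w z" by (simp add: distrib_right)
      finally show ?case .
    qed
  qed
qed

text \<open>This is continuity of \<open>\<Phi>\<close> at \<open>z\<close>, read off from the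
  Lipschitz estimate. It pulls identities of germs back through a change of coordinates.\<close>

lemma eventually_cnhds_compose:
  assumes z: "z \<in> cspace n" and d: "\<forall>i<n. complex_differentiable n (\<lambda>w. \<Phi> w i) z"
    and \<Phi>: "\<Phi> z \<in> cspace n" "\<forall>\<^sub>F w in cnhds n z. \<Phi> w \<in> cspace n"
    and P: "eventually P (cnhds n (\<Phi> z))"
  shows "\<forall>\<^sub>F w in cnhds n z. P (\<Phi> w)"
proof -
  obtain K where K: "K > 0" "\<forall>\<^sub>F w in cnhds n z. cdist n (\<Phi> w) (\<Phi> z) \<le> K * cdist n w z"
    by (rule complex_differentiable_map_lipschitz[OF z d]) (rule that)
  obtain r where r: "r > 0" "\<forall>w\<in>cspace n. cdist n w (\<Phi> z) < r \<longrightarrow> P w"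
    using P unfolding eventually_cnhds[OF \<Phi>(1)] by (elim exE conjE) (rule that)
  have "\<forall>\<^sub>F w in cnhds n z. cdist n w z < r / K"
    unfolding eventually_cnhds[OF z] using r(1) K(1) by (intro exI[of _ "r / K"]) simp
  with K(2) \<Phi>(2) show ?thesis
  proof eventually_elim
    case (elim w)
    then have "K * cdist n w z < r" using K(1) by (simp add: field_simps)
    then show ?case using elim r(2) by auto
  qed
qed

text \<open>The coordinate change given by right equivalence is only Frechet differentiable, so the
  chain rule is proved for that notion. The error splits into that of \<open>f\<close>, scaled by
  the Lipschitz constant \<open>K\<close> of \<open>\<Phi>\<close>, and that of
  \<open>\<Phi>\<close>, scaled by the coefficients of the differential of \<open>f\<close>.\<close>

lemma complex_differentiable_compose:
  assumes z: "z \<in> cspace n" and d: "\<forall>i<n. complex_differentiable n (\<lambda>w. \<Phi> w i) z"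
    and \<Phi>: "\<Phi> z \<in> cspace n" "\<forall>\<^sub>F w in cnhds n z. \<Phi> w \<in> cspace n"
    and f: "complex_differentiable n f (\<Phi> z)"
  shows "complex_differentiable n (\<lambda>w. f (\<Phi> w)) z"
proof -
  obtain K where K: "K > 0" "\<forall>\<^sub>F w in cnhds n z. cdist n (\<Phi> w) (\<Phi> z) \<le> K * cdist n w z"
    by (rule complex_differentiable_map_lipschitz[OF z d]) (rule that)
  obtain a where a: "\<forall>e>0. \<forall>\<^sub>F w in cnhds n z.
     \<forall>i<n. cmod (\<Phi> w i - \<Phi> z i - linform n (a i) (\<lambda>i. w i - z i)) \<le> e * cdist n w z"
    by (rule complex_differentiable_family[OF z, where \<Phi> = \<Phi>]) (use d in simp, rule that)
  obtain c where c: "\<forall>e>0. \<forall>\<^sub>F w in cnhds n (\<Phi> z).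
       cmod (f w - f (\<Phi> z) - linform n c (\<lambda>i. w i - \<Phi> z i)) \<le> e * cdist n w (\<Phi> z)"
    using f unfolding complex_differentiable_iff[OF \<Phi>(1)] by (elim exE) (rule that)
  define C where "C = (\<Sum>i<n. cmod (c i)) + 1"
  have C: "C > 0" unfolding C_def by (smt (verit) norm_ge_zero sum_nonneg)
  have lin: "linform n (\<lambda>i. \<Sum>j<n. c j * a j i) v = (\<Sum>j<n. c j * linform n (a j) v)" for v
    unfolding linform_def sum_distrib_left sum_distrib_right
    by (subst sum.swap) (simp add: mult.assoc)
  show ?thesis
    unfolding complex_differentiable_iff[OF z]
  proof (intro exI[of _ "\<lambda>i. \<Sum>j<n. c j * a j i"] allI impI)
    fix e :: real assume e: "e > 0"
    have e1: "e / (2 * K) > 0" and e2: "e / (2 * C) > 0" using e K C by simp_all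
    show "\<forall>\<^sub>F w in cnhds n z. cmod (f (\<Phi> w) - f (\<Phi> z) -
        linform n (\<lambda>i. \<Sum>j<n. c j * a j i) (\<lambda>i. w i - z i)) \<le> e * cdist n w z"
      using K(2) a[rule_format, OF e2]
        eventually_cnhds_compose[OF z d \<Phi> c[rule_format, OF e1]]
    proof eventually_elim
      case (elim w)
      have *: "f (\<Phi> w) - f (\<Phi> z) - linform n (\<lambda>i. \<Sum>j<n. c j * a j i) (\<lambda>i. w i - z i) =
         (f (\<Phi> w) - f (\<Phi> z) - linform n c (\<lambda>i. \<Phi> w i - \<Phi> z i)) +
         (\<Sum>j<n. c j * (\<Phi> w j - \<Phi> z j - linform n (a j) (\<lambda>i. w i - z i)))"
        unfolding lin linform_def[of n c] right_diff_distrib[of "c _"] sum_subtractf by simp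
      have "cmod (f (\<Phi> w) - f (\<Phi> z) - linform n c (\<lambda>i. \<Phi> w i - \<Phi> z i)) \<le> e / (2 * K) * (K * cdist n w z)"
        using elim(3) mult_left_mono[OF elim(1) less_imp_le[OF e1]] by linarith
      also have "\<dots> = e / 2 * cdist n w z" using K by simp
      finally have 1: "cmod (f (\<Phi> w) - f (\<Phi> z) - linform n c (\<lambda>i. \<Phi> w i - \<Phi> z i)) \<le> e / 2 * cdist n w z" .
      have "cmod (\<Sum>j<n. c j * (\<Phi> w j - \<Phi> z j - linform n (a j) (\<lambda>i. w i - z i)))
          \<le> (\<Sum>j<n. cmod (c j) * (e / (2 * C) * cdist n w z))"
        by (rule sum_norm_le, unfold norm_mult) (rule mult_left_mono[OF elim(2)[rule_format]], simp_all)
      also have "\<dots> \<le> C * (e / (2 * C) * cdist n w z)"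
        unfolding sum_distrib_right[symmetric]
        by (rule mult_right_mono[OF _ mult_nonneg_nonneg[OF less_imp_le[OF e2] cdist_nonneg]])
          (simp add: C_def)
      also have "\<dots> = e / 2 * cdist n w z" using C by simp
      finally have 2: "cmod (\<Sum>j<n. c j * (\<Phi> w j - \<Phi> z j - linform n (a j) (\<lambda>i. w i - z i)))
          \<le> e / 2 * cdist n w z" .
      show ?case
        unfolding * by (rule norm_triangle_le) (use add_mono[OF 1 2] in simp)
    qed
  qed
qed

lemma holomorphic_mapD:
  assumes "holomorphic_map_Cn n \<phi> U" "openin (top_of_set (cspace n)) U" "z \<in> U"
  shows "z \<in> cspace n" "\<phi> z \<in> cspace n" "\<forall>\<^sub>F w in cnhds n z. w \<in> U"
    "\<forall>\<^sub>F w in cnhds n z. \<phi> w \<in> cspace n"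
    "\<forall>i<n. complex_differentiable n (\<lambda>w. \<phi> w i) z"
proof -
  show "\<forall>\<^sub>F w in cnhds n z. w \<in> U" using assms unfolding openin_cspace_iff by blast
  then show "\<forall>\<^sub>F w in cnhds n z. \<phi> w \<in> cspace n"
    by (rule eventually_mono) (use assms(1) in \<open>auto simp: holomorphic_map_Cn_def\<close>)
  show "z \<in> cspace n" using assms unfolding openin_cspace_iff by blast
  show "\<phi> z \<in> cspace n" using assms unfolding holomorphic_map_Cn_def by blast
  show "\<forall>i<n. complex_differentiable n (\<lambda>w. \<phi> w i) z"
    using assms unfolding holomorphic_map_Cn_def holomorphic_Cn_def by blast
qed

lemma openin_holomorphic_preimage:
  assumes "holomorphic_map_Cn n \<phi> U" "openin (top_of_set (cspace n)) U"
    "openin (top_of_set (cspace n)) V"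
  shows "openin (top_of_set (cspace n)) {z \<in> U. \<phi> z \<in> V}"
  unfolding openin_cspace_iff
proof (intro conjI ballI)
  show "{z \<in> U. \<phi> z \<in> V} \<subseteq> cspace n" using assms(2) unfolding openin_cspace_iff by blast
  fix z assume z: "z \<in> {z \<in> U. \<phi> z \<in> V}"
  then have zU: "z \<in> U" and zV: "\<phi> z \<in> V" by auto
  note D = holomorphic_mapD[OF assms(1,2) zU]
  have "\<forall>\<^sub>F y in cnhds n (\<phi> z). y \<in> V"
    using assms(3) zV unfolding openin_cspace_iff by blast
  from eventually_cnhds_compose[OF D(1) D(5) D(2) D(4) this] D(3)
  show "\<forall>\<^sub>F w in cnhds n z. w \<in> {z \<in> U. \<phi> z \<in> V}"
    by eventually_elim simp
qed

text \<open>The map \<open>h\<close> has to agree with the composite only on \<open>W\<close>. This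
  form suits \<open>inv_into\<close> of a composite, which is identified with the composite of the
  inverses only on its domain.\<close>

lemma holomorphic_map_compose:
  assumes \<phi>: "holomorphic_map_Cn n \<phi> U" "openin (top_of_set (cspace n)) U"
    and \<psi>: "holomorphic_map_Cn n \<psi> V" "openin (top_of_set (cspace n)) V"
    and W: "openin (top_of_set (cspace n)) W" "W \<subseteq> V" "\<And>z. z \<in> W \<Longrightarrow> \<psi> z \<in> U"
    and h: "\<And>z. z \<in> W \<Longrightarrow> h z = \<phi> (\<psi> z)"
  shows "holomorphic_map_Cn n h W"
  unfolding holomorphic_map_Cn_def holomorphic_Cn_def
proof (intro conjI allI impI ballI W(1))
  show "h ` W \<subseteq> cspace n"
    using h W(3) \<phi>(1) unfolding holomorphic_map_Cn_def by auto
  fix i z assume i: "i < n" and z: "z \<in> W"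
  then have zV: "z \<in> V" and zU: "\<psi> z \<in> U" using W by auto
  note D = holomorphic_mapD[OF \<psi> zV] and E = holomorphic_mapD[OF \<phi> zU]
  have "complex_differentiable n (\<lambda>w. \<phi> (\<psi> w) i) z"
    using complex_differentiable_compose[OF D(1) D(5) D(2) D(4) E(5)[rule_format, OF i]] .
  then show "complex_differentiable n (\<lambda>z. h z i) z"
  proof (rule complex_differentiable_cong[OF D(1)])
    have "\<forall>\<^sub>F w in cnhds n z. w \<in> W" using W(1) z unfolding openin_cspace_iff by blast
    then show "\<forall>\<^sub>F w in cnhds n z. \<phi> (\<psi> w) i = h w i"
      by (rule eventually_mono) (simp add: h)
  qed
qed

lemma local_biholomorphism_compose:
  assumes "local_biholomorphism n \<phi>" "local_biholomorphism n \<psi>"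
  shows "local_biholomorphism n (\<phi> \<circ> \<psi>)"
proof -
  from assms(1) obtain U1 V1 where \<phi>: "\<phi> origin = origin" "open_nbhd0 n U1" "open_nbhd0 n V1"
    "bij_betw \<phi> U1 V1" "holomorphic_map_Cn n \<phi> U1" "holomorphic_map_Cn n (inv_into U1 \<phi>) V1"
    unfolding local_biholomorphism_def by (elim exE conjE) (rule that)
  from assms(2) obtain U2 V2 where \<psi>: "\<psi> origin = origin" "open_nbhd0 n U2" "open_nbhd0 n V2"
    "bij_betw \<psi> U2 V2" "holomorphic_map_Cn n \<psi> U2" "holomorphic_map_Cn n (inv_into U2 \<psi>) V2"
    unfolding local_biholomorphism_def by (elim exE conjE) (rule that)
  define \<phi>' where "\<phi>' = inv_into U1 \<phi>"
  define \<psi>' where "\<psi>' = inv_into U2 \<psi>"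
  have inv1: "\<phi>' (\<phi> z) = z" "\<phi> z \<in> V1" if "z \<in> U1" for z
    using that \<phi>(4) unfolding \<phi>'_def bij_betw_def by (auto intro: inv_into_f_f)
  have inv1': "\<phi> (\<phi>' y) = y" "\<phi>' y \<in> U1" if "y \<in> V1" for y
    using that \<phi>(4) unfolding \<phi>'_def bij_betw_def by (auto intro: f_inv_into_f inv_into_into)
  have inv2: "\<psi>' (\<psi> z) = z" "\<psi> z \<in> V2" if "z \<in> U2" for z
    using that \<psi>(4) unfolding \<psi>'_def bij_betw_def by (auto intro: inv_into_f_f)
  have inv2': "\<psi> (\<psi>' y) = y" "\<psi>' y \<in> U2" if "y \<in> V2" for y
    using that \<psi>(4) unfolding \<psi>'_def bij_betw_def by (auto intro: f_inv_into_f inv_into_into)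
  note op = \<phi>(2,3)[unfolded open_nbhd0_def] \<psi>(2,3)[unfolded open_nbhd0_def]
  define U where "U = {z \<in> U2. \<psi> z \<in> U1}"
  define V where "V = {y \<in> V1. \<phi>' y \<in> V2}"
  have Uo: "openin (top_of_set (cspace n)) U"
    unfolding U_def using openin_holomorphic_preimage[OF \<psi>(5)] op by blast
  have Vo: "openin (top_of_set (cspace n)) V"
    unfolding V_def \<phi>'_def using openin_holomorphic_preimage[OF \<phi>(6)] op by blast
  have fU: "(\<phi> \<circ> \<psi>) z \<in> V" "\<psi>' (\<phi>' ((\<phi> \<circ> \<psi>) z)) = z" if "z \<in> U" for z
    using that by (simp_all add: U_def V_def inv1 inv2)
  have fV: "\<psi>' (\<phi>' y) \<in> U" "(\<phi> \<circ> \<psi>) (\<psi>' (\<phi>' y)) = y" if "y \<in> V" for y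
    using that by (simp_all add: U_def V_def inv1' inv2')
  have bij: "bij_betw (\<phi> \<circ> \<psi>) U V"
    by (rule bij_betw_byWitness[where f' = "\<lambda>y. \<psi>' (\<phi>' y)"]) (use fU fV in auto)
  have inv: "inv_into U (\<phi> \<circ> \<psi>) y = \<psi>' (\<phi>' y)" if "y \<in> V" for y
    using inv_into_f_f[OF bij_betw_imp_inj_on[OF bij] fV(1)[OF that]] fV(2)[OF that] by simp
  have comp0: "(\<phi> \<circ> \<psi>) origin = origin" by (simp add: \<phi> \<psi>)
  show ?thesis
    unfolding local_biholomorphism_def
  proof (rule conjI, rule comp0, rule exI[of _ U], rule exI[of _ V], intro conjI)
    have oU: "origin \<in> U" using op \<psi>(1) by (simp add: U_def)
    have "(\<phi> \<circ> \<psi>) origin \<in> V" by (rule fU(1)[OF oU])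
    then have "origin \<in> V" by (simp add: \<phi> \<psi>)
    with oU show "open_nbhd0 n U" "open_nbhd0 n V"
      using Uo Vo by (simp_all add: open_nbhd0_def)
    show "holomorphic_map_Cn n (\<phi> \<circ> \<psi>) U"
      by (rule holomorphic_map_compose[OF \<phi>(5) _ \<psi>(5) _ Uo]) (use op in \<open>auto simp: U_def\<close>)
    show "holomorphic_map_Cn n (inv_into U (\<phi> \<circ> \<psi>)) V"
      by (rule holomorphic_map_compose[OF \<psi>(6) _ \<phi>(6) _ Vo])
        (use op inv in \<open>auto simp: V_def \<phi>'_def \<psi>'_def\<close>)
  qed (rule bij)
qed

text \<open>The two substitutions point the same way: \<open>h = f \<circ> \<phi>\<close> and
  \<open>p = h \<circ> \<Phi>\<close> give \<open>p = f \<circ> (\<phi> \<circ> \<Phi>)\<close>, so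
  composing suffices and right equivalence need not be inverted.\<close>

lemma right_equivalent_transfer:
  assumes f: "right_equivalent n f h" and \<Phi>: "local_biholomorphism n \<Phi>"
    and p: "\<forall>\<^sub>F z in cnhds n origin. p z = h (\<Phi> z)"
  shows "right_equivalent n f p"
proof -
  obtain \<phi> where \<phi>: "local_biholomorphism n \<phi>" "germ_eq n h (f \<circ> \<phi>)"
    using f unfolding right_equivalent_def by blast
  from \<Phi> obtain U V where U: "\<Phi> origin = origin" "open_nbhd0 n U" "holomorphic_map_Cn n \<Phi> U"
    unfolding local_biholomorphism_def by (elim exE conjE) (rule that)
  have Uo: "openin (top_of_set (cspace n)) U" "origin \<in> U"
    using U(2) by (simp_all add: open_nbhd0_def)
  note D = holomorphic_mapD[OF U(3) Uo]
  have "\<forall>\<^sub>F z in cnhds n (\<Phi> origin). h z = (f \<circ> \<phi>) z"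
    using \<phi>(2) unfolding germ_eq_def eventually_cnhds_origin[symmetric] U(1) .
  from eventually_cnhds_compose[OF D(1) D(5) D(2) D(4) this] p
  have "\<forall>\<^sub>F z in cnhds n origin. p z = (f \<circ> (\<phi> \<circ> \<Phi>)) z"
    by eventually_elim simp
  then have "germ_eq n p (f \<circ> (\<phi> \<circ> \<Phi>))"
    unfolding germ_eq_def eventually_cnhds_origin .
  then show ?thesis
    unfolding right_equivalent_def using local_biholomorphism_compose[OF \<phi>(1) \<Phi>] by blast
qed

section \<open>Polynomials of bounded degree\<close>

text \<open>An upper bound on the degree, in place of its exact value, makes sums harmless when
  terms cancel. Polynomials can then be handled as functions until the minimal degree is
  estimated.\<close>

definition poly_fun :: "nat \<Rightarrow> nat \<Rightarrow> ((nat \<Rightarrow> complex) \<Rightarrow> complex) \<Rightarrow> bool" where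
  "poly_fun n D f \<longleftrightarrow> (\<exists>p\<in>polys_in n. total_degree p \<le> D \<and> (\<forall>z. poly_eval p z = f z))"

lemma total_degree_le_iff:
  "total_degree p \<le> D \<longleftrightarrow>
    (\<forall>m\<in>Poly_Mapping.keys p. (\<Sum>i\<in>Poly_Mapping.keys m. Poly_Mapping.lookup m i) \<le> D)"
  unfolding total_degree_def by (subst Max_le_iff) auto

lemma poly_eval_superset:
  assumes "finite S" "Poly_Mapping.keys p \<subseteq> S"
  shows "poly_eval p z = (\<Sum>m\<in>S. Poly_Mapping.lookup p m *
     (\<Prod>i\<in>Poly_Mapping.keys m. z i ^ Poly_Mapping.lookup m i))"
  unfolding poly_eval_def
  by (rule sum.mono_neutral_left[OF assms]) (auto simp: in_keys_iff)

lemma poly_fun_add: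
  assumes "poly_fun n D f" "poly_fun n D g"
  shows "poly_fun n D (\<lambda>z. f z + g z)"
proof -
  obtain p where p: "p \<in> polys_in n" "total_degree p \<le> D" "\<And>z. poly_eval p z = f z"
    using assms(1) unfolding poly_fun_def by blast
  obtain q where q: "q \<in> polys_in n" "total_degree q \<le> D" "\<And>z. poly_eval q z = g z"
    using assms(2) unfolding poly_fun_def by blast
  let ?S = "Poly_Mapping.keys p \<union> Poly_Mapping.keys q"
  have keys: "Poly_Mapping.keys (p + q) \<subseteq> ?S" by (rule Poly_Mapping.keys_add)
  have "poly_eval (p + q) z = f z + g z" for z
    using poly_eval_superset[OF _ keys, of z] poly_eval_superset[of ?S p z]
      poly_eval_superset[of ?S q z] p(3)[of z] q(3)[of z]
    by (simp add: lookup_add distrib_right sum.distrib)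
  moreover have "p + q \<in> polys_in n"
    using p(1) q(1) keys unfolding polys_in_def by blast
  moreover have "total_degree (p + q) \<le> D"
    using p(2) q(2) keys unfolding total_degree_le_iff by blast
  ultimately show ?thesis unfolding poly_fun_def by blast
qed

lemma poly_fun_monomial:
  assumes "(\<Sum>i<n. a i) \<le> D"
  shows "poly_fun n D (\<lambda>z. c * (\<Prod>i<n. z i ^ a i))"
proof -
  define m where "m = Poly_Mapping.Abs_poly_mapping (\<lambda>i. if i < n then a i else 0)"
  have lookup: "Poly_Mapping.lookup m i = (if i < n then a i else 0)" for i
    unfolding m_def by (subst Poly_Mapping.lookup_Abs_poly_mapping) auto
  have keys: "Poly_Mapping.keys m \<subseteq> {..<n}"
    by (auto simp: in_keys_iff lookup split: if_splits)
  have deg: "(\<Sum>i\<in>Poly_Mapping.keys m. Poly_Mapping.lookup m i) \<le> D"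
  proof -
    have "(\<Sum>i\<in>Poly_Mapping.keys m. Poly_Mapping.lookup m i) = (\<Sum>i<n. Poly_Mapping.lookup m i)"
      by (rule sum.mono_neutral_left) (use keys in \<open>auto simp: in_keys_iff\<close>)
    then show ?thesis using assms by (simp add: lookup)
  qed
  have mon: "(\<Prod>i\<in>Poly_Mapping.keys m. z i ^ Poly_Mapping.lookup m i) = (\<Prod>i<n. z i ^ a i)"
    for z :: "nat \<Rightarrow> complex"
  proof -
    have "(\<Prod>i\<in>Poly_Mapping.keys m. z i ^ Poly_Mapping.lookup m i) = (\<Prod>i<n. z i ^ Poly_Mapping.lookup m i)"
      by (rule prod.mono_neutral_left) (use keys in \<open>auto simp: in_keys_iff\<close>)
    then show ?thesis by (simp add: lookup)
  qed
  let ?p = "Poly_Mapping.single m c"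
  have kp: "Poly_Mapping.keys ?p \<subseteq> {m}" by simp
  have "poly_eval ?p z = c * (\<Prod>i<n. z i ^ a i)" for z
    using poly_eval_superset[OF _ kp, of z] mon by simp
  moreover have "?p \<in> polys_in n" using kp keys unfolding polys_in_def by blast
  moreover have "total_degree ?p \<le> D" using kp deg unfolding total_degree_le_iff by blast
  ultimately show ?thesis unfolding poly_fun_def by blast
qed

lemma poly_fun_two_powers:
  assumes "i < n" "j < n" "p + q \<le> D"
  shows "poly_fun n D (\<lambda>z. c * (z i ^ p * z j ^ q))"
proof -
  \<comment> \<open>Adding the two exponents, instead of choosing by cases, also covers
    \<open>i = j\<close>, which is how pure powers are obtained.\<close>
  let ?a = "\<lambda>l. (if l = i then p else 0) + (if l = j then q else 0)"
  have "(\<Sum>l<n. ?a l) \<le> D" using assms by (simp add: sum.distrib)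
  then have "poly_fun n D (\<lambda>z. c * (\<Prod>l<n. z l ^ ?a l))" by (rule poly_fun_monomial)
  moreover have "(\<Prod>l<n. z l ^ (if l = t then s else 0)) = z t ^ s" if "t < n"
    for z :: "nat \<Rightarrow> complex" and s t
  proof -
    have "(\<Prod>l<n. z l ^ (if l = t then s else 0)) = (\<Prod>l<n. if l = t then z l ^ s else 1)"
      by (rule prod.cong) auto
    then show ?thesis using that by simp
  qed
  ultimately show ?thesis
    using assms by (simp only: power_add prod.distrib)
qed

lemma poly_fun_sum:
  assumes "\<And>i. i \<in> I \<Longrightarrow> poly_fun n D (f i)"
  shows "poly_fun n D (\<lambda>z. \<Sum>i\<in>I. f i z)"
  using assms
proof (induction I rule: infinite_finite_induct)
  case (insert i I)
  then show ?case using poly_fun_add[of n D "f i" "\<lambda>z. \<Sum>i\<in>I. f i z"] by simp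
qed (use poly_fun_monomial[of "\<lambda>_. 0" n D 0] in auto)

lemma poly_fun_normal_form:
  assumes n: "n > 0" and D: "k + 1 \<le> D" "2 \<le> D"
  shows "poly_fun n D (\<lambda>y. y 0 ^ (k + 1) + (\<Sum>i=1..<n. (y i)\<^sup>2))"
proof (intro poly_fun_add poly_fun_sum)
  show "poly_fun n D (\<lambda>y. y 0 ^ (k + 1))"
    using poly_fun_two_powers[of 0 n 0 "k + 1" 0 D 1] n D by simp
  show "poly_fun n D (\<lambda>y. (y i)\<^sup>2)" if "i \<in> {1..<n}" for i
    using poly_fun_two_powers[of i n i 2 0 D 1] that D by simp
qed

lemma poly_fun_witness:
  assumes n: "n = Suc m" and d: "d \<ge> 1" and D: "2 * d \<le> D" "(\<Sum>i<n. a i) \<le> D"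
  shows "poly_fun n D (\<lambda>z. (\<Prod>i<n. z i ^ a i) + (\<Sum>i<m. (z (Suc i) - z i ^ d)\<^sup>2))"
proof (intro poly_fun_add poly_fun_sum)
  show "poly_fun n D (\<lambda>z. \<Prod>i<n. z i ^ a i)"
    using poly_fun_monomial[OF D(2), of 1] by simp
  fix i assume "i \<in> {..<m}"
  then have i: "i < n" "Suc i < n" using n by auto
  have "poly_fun n D (\<lambda>z. 1 * (z (Suc i) ^ 2 * z i ^ 0) +
      (- 2 * (z (Suc i) ^ 1 * z i ^ d) + 1 * (z (Suc i) ^ 0 * z i ^ (2 * d))))"
    by (intro poly_fun_add poly_fun_two_powers i) (use d D in auto)
  moreover have "1 * (z (Suc i) ^ 2 * z i ^ 0) +
      (- 2 * (z (Suc i) ^ 1 * z i ^ d) + 1 * (z (Suc i) ^ 0 * z i ^ (2 * d))) = (z (Suc i) - z i ^ d)\<^sup>2"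
    for z :: "nat \<Rightarrow> complex"
    by (simp add: power2_diff power_even_eq)
  ultimately show "poly_fun n D (\<lambda>z. (z (Suc i) - z i ^ d)\<^sup>2)" by (simp only:)
qed

lemma min_poly_degree_le:
  assumes "poly_fun n D h" "right_equivalent n f h"
  shows "min_poly_degree n f \<le> enat D"
proof -
  obtain p where p: "p \<in> polys_in n" "total_degree p \<le> D" "\<And>z. poly_eval p z = h z"
    using assms(1) unfolding poly_fun_def by blast
  have "poly_eval p = h" using p(3) by (rule ext)
  then have "min_poly_degree n f \<le> enat (total_degree p)"
    unfolding min_poly_degree_def using p(1) assms(2) by (intro INF_lower) simp
  also have "\<dots> \<le> enat D" using p(2) by simp
  finally show ?thesis .
qed

section \<open>Choice of the digits and the degree bound\<close>

text \<open>Only the first \<open>m\<close> digits are restricted; the last one absorbs the rest, so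
  any \<open>N\<close> is represented with a fixed number of digits. Each induction step divides
  this last digit by \<open>d\<close> with remainder.\<close>

lemma digit_expansion:
  fixes d :: nat
  assumes "d \<ge> 1"
  shows "\<exists>a. (\<forall>i<m. a i < d) \<and> (\<Sum>i<Suc m. a i * d ^ i) = N"
proof (induction m)
  case 0
  show ?case by (intro exI[of _ "\<lambda>_. N"]) simp
next
  case (Suc m)
  then obtain a where a: "\<forall>i<m. a i < d" "(\<Sum>i<Suc m. a i * d ^ i) = N" by blast
  let ?b = "a(m := a m mod d, Suc m := a m div d)"
  have "(\<Sum>i<Suc (Suc m). ?b i * d ^ i) =
      (\<Sum>i<m. a i * d ^ i) + ((a m mod d) * d ^ m + (a m div d) * d ^ Suc m)"
    by simp
  also have "(a m mod d) * d ^ m + (a m div d) * d ^ Suc m = (a m mod d + d * (a m div d)) * d ^ m"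
    unfolding distrib_right by (simp only: power_Suc mult_ac)
  also have "a m mod d + d * (a m div d) = a m" by simp
  finally have "(\<Sum>i<Suc (Suc m). ?b i * d ^ i) = N" using a(2) by simp
  then show ?case
    using a(1) assms by (intro exI[of _ ?b]) (auto simp: less_Suc_eq)
qed

lemma right_equivalent_witness:
  assumes f: "type_A n k f" and d: "d \<ge> 2" and n: "n = Suc m"
    and N: "k + 1 = (\<Sum>i<n. a i * d ^ i)" "2 * d ^ m < k + 1"
  shows "right_equivalent n f (\<lambda>z. (\<Prod>i<n. z i ^ a i) + (\<Sum>i<m. (z (Suc i) - z i ^ d)\<^sup>2))"
proof -
  obtain X U where X: "sdiff_germ n X" "X origin = 0" "sdiff n X origin (\<lambda>j. if j = 0 then 1 else 0)"
    and U: "\<forall>i<m. sdiff_germ n (U i) \<and> U i origin = 0 \<and>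
      sdiff n (U i) origin (\<lambda>j. if j = Suc i then 1 else 0)"
    and eq: "\<forall>\<^sub>F z in cnhds n origin. (\<Prod>i<n. z i ^ a i) + (\<Sum>i<m. (z (Suc i) - z i ^ d)\<^sup>2)
       = X z ^ (k + 1) + (\<Sum>i<m. (U i z)\<^sup>2)"
    using diagonalize_witness[OF d n N] by (elim exE conjE) (rule that)
  \<comment> \<open>The normal form has its high power in coordinate \<open>0\<close>, hence the
    shift by one in \<open>U\<close>. The value \<open>0\<close> from index \<open>n\<close> on
    keeps the image in \<open>cspace n\<close>.\<close>
  define \<Phi> where "\<Phi> = (\<lambda>z i. if i = 0 then X z else if i < n then U (i - 1) z else 0)"
  have \<Phi>0: "\<Phi> z 0 = X z" and \<Phi>Suc: "i < m \<Longrightarrow> \<Phi> z (Suc i) = U i z" for z i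
    by (simp_all add: \<Phi>_def n)
  have "local_biholomorphism n \<Phi>"
  proof (rule inverse_function_cspace)
    show "n > 0" using n by simp
    show "\<Phi> origin = origin"
    proof
      fix i
      show "\<Phi> origin i = 0"
        using X(2) U by (cases i) (auto simp: \<Phi>_def n)
    qed
    show "\<Phi> z \<in> cspace n" for z by (simp add: \<Phi>_def cspace_def n)
    fix i assume "i < n"
    then show "sdiff_germ n (\<lambda>z. \<Phi> z i)" "sdiff n (\<lambda>z. \<Phi> z i) origin (\<lambda>j. if j = i then 1 else 0)"
      using X U by (cases i; simp add: \<Phi>0 \<Phi>Suc n)+
  qed
  then show ?thesis
  proof (rule right_equivalent_transfer[OF f[unfolded type_A_def]])
    have "(\<Sum>i=1..<n. (\<Phi> z i)\<^sup>2) = (\<Sum>i<m. (U i z)\<^sup>2)" for z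
    proof -
      have "(\<Sum>i=1..<n. (\<Phi> z i)\<^sup>2) = (\<Sum>i=0..<m. (\<Phi> z (Suc i))\<^sup>2)"
        unfolding n One_nat_def by (rule sum.shift_bounds_Suc_ivl)
      also have "\<dots> = (\<Sum>i=0..<m. (U i z)\<^sup>2)" by (rule sum.cong) (auto simp: \<Phi>Suc)
      finally show ?thesis by (simp add: atLeast0LessThan)
    qed
    then show "\<forall>\<^sub>F z in cnhds n origin. (\<Prod>i<n. z i ^ a i) + (\<Sum>i<m. (z (Suc i) - z i ^ d)\<^sup>2)
      = \<Phi> z 0 ^ (k + 1) + (\<Sum>i=1..<n. (\<Phi> z i)\<^sup>2)"
      using eq by (simp only: \<Phi>0)
  qed
qed

text \<open>For the integer part \<open>d\<close> of the root,
  \<open>k + 1 \<le> (d + 1) ^ n \<le> (2 * d) ^ n\<close>, so the leading digit, which multiplies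
  \<open>d ^ m\<close>, is at most \<open>2 ^ n * d\<close>. The other digits are below
  \<open>d\<close>, and summing \<open>n\<close> digits gives the constant \<open>n * 2 ^ n\<close>.
  It also dominates the \<open>2 * d\<close> coming from the squares, and the degree of the normal
  form when \<open>d = 1\<close>.\<close>

lemma min_poly_degree_bound:
  assumes n: "n \<ge> 1" and k: "k \<ge> 1" and f: "type_A n k f"
  shows "\<exists>d. d ^ n \<le> k \<and> min_poly_degree n f \<le> enat (n * 2 ^ n * d)"
proof -
  obtain m where m: "n = Suc m" using n by (cases n) auto
  define d where "d = nat \<lfloor>root n (real k)\<rfloor>"
  have root1: "root n (real k) \<ge> 1" using n k by simp
  have d1: "d \<ge> 1" unfolding d_def using root1 by (simp add: le_nat_iff)
  have "real d \<le> root n (real k)" "root n (real k) < real d + 1"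
    unfolding d_def using root1 by auto
  then have "real d ^ n \<le> root n (real k) ^ n" "root n (real k) ^ n < (real d + 1) ^ n"
    using n root1 by - (rule power_mono power_strict_mono; simp del: real_root_pow_pos2)+
  then have "real d ^ n \<le> real k" "real k < (real d + 1) ^ n"
    using n by simp_all
  then have dk: "d ^ n \<le> k" "k < (d + 1) ^ n"
    by (simp_all flip: of_nat_power of_nat_Suc add: add.commute)
  have "2 ^ n \<le> n * (2::nat) ^ n" using n by simp
  moreover have "2 \<le> (2::nat) ^ n" using n by (simp add: self_le_power)
  ultimately have n2: "2 \<le> n * 2 ^ n" "2 ^ n \<le> n * (2::nat) ^ n" by linarith+
  show ?thesis
  proof (cases "d = 1")
    case True
    then have "k < 2 ^ n" using dk(2) by (simp only: one_add_one)
    then have "k + 1 \<le> n * 2 ^ n" using n2(2) by linarith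
    then have "poly_fun n (n * 2 ^ n * d) (\<lambda>y. y 0 ^ (k + 1) + (\<Sum>i=1..<n. (y i)\<^sup>2))"
      using True n n2 by (intro poly_fun_normal_form) auto
    from min_poly_degree_le[OF this] f dk show ?thesis
      unfolding type_A_def by blast
  next
    case False
    then have d2: "d \<ge> 2" using d1 by simp
    obtain a where a: "\<forall>i<m. a i < d" "(\<Sum>i<n. a i * d ^ i) = k + 1"
      using digit_expansion[OF d1, of m "k + 1"] unfolding m by blast
    \<comment> \<open>One of the \<open>n\<close> factors \<open>d\<close> pays for the
      \<open>2\<close>; the result is the inequality that the diagonalization demands of the
      weights.\<close>
    have "2 * d ^ m \<le> d ^ n" using d2 by (simp add: m)
    then have big: "2 * d ^ m < k + 1" using dk by linarith
    have "a m * d ^ m \<le> k + 1"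
      using a(2) by (simp add: m)
    also have "\<dots> \<le> (d + 1) ^ n" using dk by simp
    also have "\<dots> \<le> (2 * d) ^ n" using d1 by (intro power_mono) auto
    also have "\<dots> = (2 ^ n * d) * d ^ m" by (simp add: m power_mult_distrib)
    finally have am: "a m \<le> 2 ^ n * d" using d1 by simp
    have "(\<Sum>i<n. a i) \<le> (\<Sum>i<n. 2 ^ n * d)"
    proof (rule sum_mono)
      fix i assume "i \<in> {..<n}"
      then consider "i = m" | "i < m" using m by fastforce
      then show "a i \<le> 2 ^ n * d"
      proof cases
        case 2
        then have "a i \<le> d" using a(1) by (simp add: less_imp_le)
        also have "\<dots> \<le> 2 ^ n * d" by simp
        finally show ?thesis .
      qed (use am in simp)
    qed
    then have "(\<Sum>i<n. a i) \<le> n * 2 ^ n * d" by simp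
    moreover have "2 * d \<le> n * 2 ^ n * d" using n2(1) by (rule mult_le_mono1)
    ultimately have "poly_fun n (n * 2 ^ n * d)
        (\<lambda>z. (\<Prod>i<n. z i ^ a i) + (\<Sum>i<m. (z (Suc i) - z i ^ d)\<^sup>2))"
      using d1 by (intro poly_fun_witness[OF m])
    from min_poly_degree_le[OF this right_equivalent_witness[OF f d2 m a(2)[symmetric] big]] dk
    show ?thesis by blast
  qed
qed

theorem theorem6:
  shows "\<exists>a :: nat \<Rightarrow> real. (\<forall>n\<ge>1. a n > 0) \<and>
    (\<forall>n k :: nat. \<forall>f :: (nat \<Rightarrow> complex) \<Rightarrow> complex.
       n \<ge> 1 \<longrightarrow> k \<ge> 1 \<longrightarrow> holomorphic_germ n f \<longrightarrow> type_A n k f \<longrightarrow>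
       ereal_of_enat (min_poly_degree n f) \<le> ereal (a n * root n (real k)))"
proof (intro exI[of _ "\<lambda>n. real (n * 2 ^ n)"] conjI allI impI)
  fix n :: nat assume "n \<ge> 1"
  then show "real (n * 2 ^ n) > 0" by simp
next
  fix n k :: nat and f :: "(nat \<Rightarrow> complex) \<Rightarrow> complex"
  assume n: "n \<ge> 1" and k: "k \<ge> 1" and f: "type_A n k f"
  obtain d where d: "d ^ n \<le> k" "min_poly_degree n f \<le> enat (n * 2 ^ n * d)"
    using min_poly_degree_bound[OF n k f] by blast
  have "real d ^ n \<le> real k" using d(1) by (simp flip: of_nat_power)
  then have "real d \<le> root n (real k)"
    using n real_root_le_mono[of n "real d ^ n" "real k"] by (simp add: real_root_power_cancel)
  then have "real (n * 2 ^ n * d) \<le> real (n * 2 ^ n) * root n (real k)"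
    unfolding of_nat_mult[of "n * 2 ^ n" d] by (intro mult_left_mono) simp_all
  moreover have "ereal_of_enat (min_poly_degree n f) \<le> ereal_of_enat (enat (n * 2 ^ n * d))"
    using d(2) by (simp only: ereal_of_enat_le_iff)
  ultimately show "ereal_of_enat (min_poly_degree n f) \<le> ereal (real (n * 2 ^ n) * root n (real k))"
    using order_trans by fastforce
qed

end
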